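(* Fix an integer $k\ge2$ and $t\in(0,1]$, and let $A_n\in M_{tnk}(\mathbb C)$ (for $n$ with $tnk\in\mathbb N$) satisfy $\operatorname{Tr}[A_nA_n^*]=1$, Assumption 1 ($\operatorname{Tr}[A_n]/\sqrt{tnk}=m+O(n^{-2})$ for some $m\in\mathbb C$) and Assumption 2 ($\|A_n\|_\infty=O(n^{-1/2})$). Let $|\psi_n\rangle=\sum_{i,j}(A_n)_{ij}|i\rangle|j\rangle$ and $Z_n=(\Phi_n^C\otimes\Phi_n^C)(|\psi_n\rangle\langle\psi_n|)\in M_{k^2}(\mathbb C)$ (two identical copies of the same random channel). Then the empirical eigenvalue distribution of $Z_n$ converges (almost surely) to $\delta_{1/k^2}$; in particular $\mathbb E\operatorname{Tr}[Z_n^p]\to k^{2}(k^{-2})^p$ for all $p\ge1$.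
   Context: Random channel model: $U$ Haar-distributed in $\mathcal U(nk)$ acting on $\mathbb C^k\otimes\mathbb C^n$; $V:\mathbb C^{tnk}\to\mathbb C^k\otimes\mathbb C^n$ the isometry given by the first $tnk$ columns of $U$; $\Phi_n^C(\rho)=\operatorname{Tr}_{\mathbb C^n}[V\rho V^*]\in M_k(\mathbb C)$. Both tensor factors use the same $V$. *)

theory Defs
  imports "HOL-Probability.Probability" "HOL-Library.Landau_Symbols"
    "Jordan_Normal_Form.Schur_Decomposition"
begin

definition mtrace :: "complex mat \<Rightarrow> complex" where
  "mtrace A = (\<Sum>i<dim_row A. A $$ (i, i))"

definition unitary_mat :: "nat \<Rightarrow> complex mat \<Rightarrow> bool" where
  "unitary_mat N U \<longleftrightarrow> U \<in> carrier_mat N N \<and> mat_adjoint U * U = 1\<^sub>m N"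

definition vnorm :: "complex vec \<Rightarrow> real" where
  "vnorm v = sqrt (\<Sum>i<dim_vec v. (cmod (v $ i))\<^sup>2)"

definition opnorm :: "complex mat \<Rightarrow> real" where
  "opnorm A = Sup {vnorm (A *\<^sub>v v) | v. v \<in> carrier_vec (dim_col A) \<and> vnorm v \<le> 1}"

text \<open>Kronecker product; basis vector e_i (x) e_j of C^p (x) C^q has index i*q + j.\<close>
definition kron :: "complex mat \<Rightarrow> complex mat \<Rightarrow> complex mat" where
  "kron A B = mat (dim_row A * dim_row B) (dim_col A * dim_col B)
     (\<lambda>(r, s). A $$ (r div dim_row B, s div dim_col B) * B $$ (r mod dim_row B, s mod dim_col B))"

definition ptrace2 :: "nat \<Rightarrow> nat \<Rightarrow> complex mat \<Rightarrow> complex mat" where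
  "ptrace2 k n X = mat k k (\<lambda>(a, a'). \<Sum>b<n. X $$ (a * n + b, a' * n + b))"

definition munit :: "nat \<Rightarrow> nat \<Rightarrow> nat \<Rightarrow> complex mat" where
  "munit d i j = mat d d (\<lambda>(r, s). if r = i \<and> s = j then 1 else 0)"

definition isom_cols :: "nat \<Rightarrow> complex mat \<Rightarrow> complex mat" where
  "isom_cols d U = mat (dim_row U) d (\<lambda>(i, j). U $$ (i, j))"

definition chanC :: "nat \<Rightarrow> nat \<Rightarrow> nat \<Rightarrow> complex mat \<Rightarrow> complex mat \<Rightarrow> complex mat" where
  "chanC k n d U \<rho> = ptrace2 k n (isom_cols d U * \<rho> * mat_adjoint (isom_cols d U))"

text \<open>Tensor product Phi (x) Psi of two linear maps M_d -> M_k, acting on M_{d*d},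
  defined on matrix units: (Phi (x) Psi)(E_{ii'} (x) E_{jj'}) = Phi(E_{ii'}) (x) Psi(E_{jj'}).\<close>
definition tensor_map ::
  "nat \<Rightarrow> nat \<Rightarrow> (complex mat \<Rightarrow> complex mat) \<Rightarrow> (complex mat \<Rightarrow> complex mat) \<Rightarrow> complex mat \<Rightarrow> complex mat" where
  "tensor_map d k \<Phi> \<Psi> X = mat (k * k) (k * k) (\<lambda>(r, s).
     \<Sum>i<d. \<Sum>j<d. \<Sum>i'<d. \<Sum>j'<d.
       X $$ (i * d + j, i' * d + j') * kron (\<Phi> (munit d i i')) (\<Psi> (munit d j j')) $$ (r, s))"

definition psi_vec :: "nat \<Rightarrow> complex mat \<Rightarrow> complex vec" where
  "psi_vec d A = vec (d * d) (\<lambda>r. A $$ (r div d, r mod d))"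

definition ketbra :: "complex vec \<Rightarrow> complex mat" where
  "ketbra v = mat (dim_vec v) (dim_vec v) (\<lambda>(r, s). v $ r * cnj (v $ s))"

definition mat_entries :: "nat \<Rightarrow> complex mat \<Rightarrow> (nat \<times> nat \<Rightarrow> complex)" where
  "mat_entries N U = (\<lambda>ij \<in> {..<N} \<times> {..<N}. U $$ ij)"

abbreviation mat_space :: "nat \<Rightarrow> (nat \<times> nat \<Rightarrow> complex) measure" where
  "mat_space N \<equiv> PiM ({..<N} \<times> {..<N}) (\<lambda>_. borel)"

text \<open>X is a Haar-distributed random unitary in U(N): X takes values in U(N), is measurable,
  and its law is invariant under left multiplication by every fixed unitary
  (this characterizes Haar measure uniquely).\<close>
definition haar_distributed :: "'w measure \<Rightarrow> nat \<Rightarrow> ('w \<Rightarrow> complex mat) \<Rightarrow> bool" where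
  "haar_distributed M N X \<longleftrightarrow>
     (\<forall>\<omega>\<in>space M. unitary_mat N (X \<omega>)) \<and>
     (\<lambda>\<omega>. mat_entries N (X \<omega>)) \<in> M \<rightarrow>\<^sub>M mat_space N \<and>
     (\<forall>W. unitary_mat N W \<longrightarrow>
        distr M (mat_space N) (\<lambda>\<omega>. mat_entries N (W * X \<omega>)) =
        distr M (mat_space N) (\<lambda>\<omega>. mat_entries N (X \<omega>)))"

text \<open>Empirical eigenvalue distribution (eigenvalues with algebraic multiplicity; the matrices
  considered are Hermitian, so real parts are the eigenvalues).\<close>
definition empirical_eig :: "complex mat \<Rightarrow> real measure" where
  "empirical_eig Z = measure_pmf (pmf_of_multiset (image_mset Re (proots (char_poly Z))))"

definition weak_conv_along :: "('i \<Rightarrow> real measure) \<Rightarrow> real measure \<Rightarrow> 'i filter \<Rightarrow> bool" where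
  "weak_conv_along \<mu> \<nu> F \<longleftrightarrow>
     (\<forall>f :: real \<Rightarrow> real. continuous_on UNIV f \<and> bounded (range f) \<longrightarrow>
        ((\<lambda>i. integral\<^sup>L (\<mu> i) f) \<longlongrightarrow> integral\<^sup>L \<nu> f) F)"

end

theory Submission
  imports Defs
begin

text \<open>
  With \<open>B = V A V\<^sup>T\<close> cut into \<open>n \<times> n\<close> blocks, \<open>Z\<close> is the Gram matrix of the \<open>k\<^sup>2\<close> blocks for the
  Hilbert-Schmidt product, and left invariance of the law of \<open>U\<close> means that the law of \<open>B\<close> is
  invariant under \<open>B \<mapsto> W B W\<^sup>T\<close>. For the product of two different blocks take \<open>W\<close> equal to
  \<open>D F D'\<close> on one block and to the identity elsewhere, where \<open>F\<close> is the discrete Fourier transform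
  and \<open>D\<close>, \<open>D'\<close> are random diagonal phases. Averaging over the phases bounds the second moment of
  the product by \<open>4 / n\<^sup>2 + \<parallel>A\<parallel>\<^sup>2 / n = O(n\<^sup>-\<^sup>2)\<close>. Rotating \<open>\<complex>\<^sup>k\<close> by the Fourier matrix expresses each
  diagonal entry of \<open>Z\<close> as \<open>Tr Z / k\<^sup>2 = 1 / k\<^sup>2\<close> plus off-diagonal entries. Hence
  \<open>Z - k\<^sup>-\<^sup>2 I\<close> has second moment \<open>O(n\<^sup>-\<^sup>2)\<close>, which is summable, so it tends to zero almost surely;
  the eigenvalues follow by perturbation and the moments by dominated convergence.
\<close>

section \<open>Phases with the moments of independent random phases\<close>

text \<open>Left invariance is the only feature of the Haar law that enters. It makes an expectation
  equal to its average over any finite family of fixed unitaries, and that average can then be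
  bounded pointwise, for each outcome. The random phases are therefore finite sums over
  deterministic parameters, without a second probability space. The Fourier matrix is there because
  its entries all have modulus n^(-1/2), which supplies the decay; the phases on its two sides
  remove the cross terms. The obstacle is that the index of the twisted block may occur several
  times in a product of blocks. One occurrence gives a linear average and the term with the operator
  norm; two give fourth moments of phases and the term 4/n^2; three would require sixth moments and
  are avoided by exchanging the two blocks or transposing A. The joint law of the unitaries for
  different n is arbitrary, so almost sure convergence has to come from summability of the means,
  and this is why a rate as good as n^(-2) matters.\<close>

lemma sum_roots_of_unity:
  fixes e :: int
  assumes L: "0 < L"
  shows "(\<Sum>j<L. cis (2 * pi * real j * real_of_int e / real L)) =
    (if int L dvd e then of_nat L else 0)"
proof -
  define z where "z = cis (2 * pi * real_of_int e / real L)"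
  have pw: "cis (2 * pi * real j * real_of_int e / real L) = z ^ j" for j
    unfolding z_def by (simp add: Complex.DeMoivre algebra_simps)
  have zL: "z ^ L = 1"
  proof -
    have "z ^ L = cis (2 * pi * real_of_int e)"
      using L unfolding z_def by (simp add: Complex.DeMoivre algebra_simps)
    also have "\<dots> = 1"
      by (intro cis_multiple_2pi) auto
    finally show ?thesis .
  qed
  have z1: "z = 1 \<longleftrightarrow> int L dvd e"
  proof
    assume "z = 1"
    then have "cos (2 * pi * real_of_int e / real L) = 1"
      unfolding z_def by (simp add: complex_eq_iff)
    then obtain m :: int where "2 * pi * real_of_int e / real L = real_of_int m * 2 * pi"
      using cos_one_2pi_int by (metis mult.assoc)
    then have "2 * pi * real_of_int e = 2 * pi * (real_of_int m * real L)"
      using L by (simp add: field_simps)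
    then have "real_of_int e = real_of_int (m * int L)"
      using pi_gt_zero by (simp only: mult_cancel_left) auto
    then have "e = m * int L" by (simp only: of_int_eq_iff)
    then show "int L dvd e" by simp
  next
    assume "int L dvd e"
    then obtain m where "e = int L * m" by (auto elim: dvdE)
    then have "z = cis (2 * pi * real_of_int m)"
      using L unfolding z_def by (simp add: mult.assoc)
    also have "\<dots> = 1" by (rule cis_multiple_2pi) simp
    finally show "z = 1" .
  qed
  show ?thesis
  proof (cases "z = 1")
    case True
    then show ?thesis using z1 by (simp add: pw)
  next
    case False
    then have "(\<Sum>j<L. z ^ j) = 0" using zL by (simp add: geometric_sum)
    then show ?thesis using False z1 by (simp add: pw)
  qed
qed

text \<open>Twice a power of 3 stays below the next power, so the larger exponents on the two sides
  must agree; cancelling them leaves the smaller ones.\<close>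

lemma power3_sum_eq:
  fixes x y x' y' :: nat
  shows "(3::int) ^ x + 3 ^ y = 3 ^ x' + 3 ^ y' \<longleftrightarrow> x = x' \<and> y = y' \<or> x = y' \<and> y = x'"
proof -
  have key: "a = c \<and> b = d" if "b \<le> a" "d \<le> c" "(3::int) ^ a + 3 ^ b = 3 ^ c + 3 ^ d" for a b c d :: nat
  proof -
    have le: "(3::int) ^ b \<le> 3 ^ a" "(3::int) ^ d \<le> 3 ^ c" using that by auto
    have no: "\<not> a < c" if "b \<le> a" "(3::int) ^ a + 3 ^ b = 3 ^ c + 3 ^ d" for a b c d :: nat
    proof
      assume "a < c"
      then have "(3::int) ^ Suc a \<le> 3 ^ c" by (intro power_increasing) auto
      moreover have "(3::int) ^ b \<le> 3 ^ a" using that by auto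
      moreover have "(0::int) < 3 ^ a" "(0::int) < 3 ^ d" by auto
      ultimately show False using that(2) unfolding power_Suc by linarith
    qed
    have "a = c" using no[of b a c d] no[of d c a b] that by auto
    then show ?thesis using that by simp
  qed
  show ?thesis
    using key[of y x y' x'] key[of y x x' y'] key[of x y y' x'] key[of x y x' y']
      add.commute[of "(3::int) ^ x" "3 ^ y"] add.commute[of "(3::int) ^ x'" "3 ^ y'"]
      nat_le_linear[of y x] nat_le_linear[of y' x']
    by metis
qed

text \<open>The exponents \<open>3 ^ x\<close> form a Sidon set, so these phases have the second and fourth moments of
  independent uniform phases although \<open>j\<close> is a single parameter.\<close>
definition phase :: "nat \<Rightarrow> nat \<Rightarrow> nat \<Rightarrow> complex" where
  "phase n j x = cis (2 * pi * real j * 3 ^ x / 3 ^ n)"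

lemma phase_unit: "phase n j x * cnj (phase n j x) = 1"
  unfolding phase_def by (simp add: cis_cnj cis_mult)

text \<open>Every exponent is at most 3^(n-1), so the combination \<open>e\<close> is smaller than
  3^n in absolute value. Divisibility by 3^n thus means \<open>e = 0\<close>, and the Sidon property
  decides when that happens.\<close>

lemma sum_phase4:
  assumes "x < n" "y < n" "x' < n" "y' < n"
  shows "(\<Sum>j<3 ^ n. phase n j x * phase n j y * cnj (phase n j x' * phase n j y')) =
    (if x = x' \<and> y = y' \<or> x = y' \<and> y = x' then 3 ^ n else 0)"
proof -
  define e where "e = (3::int) ^ x + 3 ^ y - 3 ^ x' - 3 ^ y'"
  have bd: "3 * (3::int) ^ z \<le> 3 ^ n" if "z < n" for z
    using power_increasing[of "Suc z" n "3::int"] that by simp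
  have "\<bar>e\<bar> < 3 ^ n"
    using bd[OF assms(1)] bd[OF assms(2)] bd[OF assms(3)] bd[OF assms(4)]
      zero_less_power[of "3::int" x] zero_less_power[of "3::int" y]
      zero_less_power[of "3::int" x'] zero_less_power[of "3::int" y']
    unfolding e_def by linarith
  then have dvd: "int (3 ^ n) dvd e \<longleftrightarrow> e = 0"
    using dvd_imp_le_int[of e "3 ^ n"] by auto
  have e0: "e = 0 \<longleftrightarrow> x = x' \<and> y = y' \<or> x = y' \<and> y = x'"
    using power3_sum_eq[of x y x' y'] unfolding e_def by auto
  have "phase n j x * phase n j y * cnj (phase n j x' * phase n j y') =
      cis (2 * pi * real j * real_of_int e / real (3 ^ n))" for j
    unfolding phase_def e_def
    by (simp add: cis_cnj cis_mult diff_divide_distrib add_divide_distrib algebra_simps)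
  then show ?thesis
    using sum_roots_of_unity[of "3 ^ n" e] e0 dvd by simp
qed

text \<open>A fourth moment in disguise: the factor 1 is written as the phase at \<open>x\<close>
  times its conjugate.\<close>

lemma sum_phase2:
  assumes "x < n" "x' < n"
  shows "(\<Sum>j<3 ^ n. phase n j x * cnj (phase n j x')) = (if x = x' then 3 ^ n else 0)"
proof -
  have "phase n j x * cnj (phase n j x') = phase n j x * phase n j x * cnj (phase n j x' * phase n j x)" for j
    using phase_unit[of n j x] by (simp add: mult_ac)
  then show ?thesis using sum_phase4[of x n x x' x] assms by (simp only:) auto
qed

section \<open>Second moments of linear and quadratic expressions in the phases\<close>

lemma sum_cmod2_eq:
  "complex_of_real (\<Sum>j\<in>J. (cmod (\<Sum>i\<in>I. g j i * a i))\<^sup>2) =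
    (\<Sum>i\<in>I. \<Sum>i'\<in>I. a i * cnj (a i') * (\<Sum>j\<in>J. g j i * cnj (g j i')))"
proof -
  have "complex_of_real (\<Sum>j\<in>J. (cmod (\<Sum>i\<in>I. g j i * a i))\<^sup>2) =
     (\<Sum>j\<in>J. (\<Sum>i\<in>I. g j i * a i) * cnj (\<Sum>i\<in>I. g j i * a i))"
    by (simp only: of_real_sum complex_norm_square)
  also have "\<dots> = (\<Sum>j\<in>J. \<Sum>i\<in>I. \<Sum>i'\<in>I. a i * cnj (a i') * (g j i * cnj (g j i')))"
    by (simp add: sum_product mult_ac)
  also have "\<dots> = (\<Sum>i\<in>I. \<Sum>i'\<in>I. \<Sum>j\<in>J. a i * cnj (a i') * (g j i * cnj (g j i')))"
    by (subst sum.swap, rule sum.cong[OF refl], rule sum.swap)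
  finally show ?thesis by (simp add: sum_distrib_left)
qed

lemma sum_phase_linear:
  "(\<Sum>j<3 ^ n. (cmod (\<Sum>x<n. phase n j x * a x))\<^sup>2) = 3 ^ n * (\<Sum>x<n. (cmod (a x))\<^sup>2)"
proof -
  have "complex_of_real (\<Sum>j<3 ^ n. (cmod (\<Sum>x<n. phase n j x * a x))\<^sup>2) =
      (\<Sum>x<n. \<Sum>x'<n. a x * cnj (a x') * (if x = x' then 3 ^ n else 0))"
    by (subst sum_cmod2_eq) (simp add: sum_phase2)
  also have "\<dots> = complex_of_real (3 ^ n * (\<Sum>x<n. (cmod (a x))\<^sup>2))"
    by (simp add: if_distrib sum.delta sum_distrib_left mult_ac flip: complex_norm_square cong: if_cong)
  finally show ?thesis by (simp only: of_real_eq_iff)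
qed

lemma sum_cmod2_eq2:
  "complex_of_real (\<Sum>j\<in>J. (cmod (\<Sum>x\<in>I. \<Sum>y\<in>K. g j x y * a x y))\<^sup>2) =
    (\<Sum>x\<in>I. \<Sum>y\<in>K. \<Sum>x'\<in>I. \<Sum>y'\<in>K. a x y * cnj (a x' y') * (\<Sum>j\<in>J. g j x y * cnj (g j x' y')))"
  using sum_cmod2_eq[of "\<lambda>j p. g j (fst p) (snd p)" "\<lambda>p. a (fst p) (snd p)" "I \<times> K" J]
  by (simp only: sum.cartesian_product' fst_conv snd_conv)

lemma sum_delta_pair:
  fixes f :: "nat \<Rightarrow> nat \<Rightarrow> complex"
  assumes "x < n" "y < n"
  shows "(\<Sum>x'<n. \<Sum>y'<n. f x' y' * of_bool (x' = x \<and> y' = y)) = f x y"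
proof -
  have "(\<Sum>x'<n. \<Sum>y'<n. f x' y' * of_bool (x' = x \<and> y' = y)) =
      (\<Sum>x'<n. if x' = x then (\<Sum>y'<n. if y' = y then f x' y' else 0) else 0)"
    by (intro sum.cong refl) (auto intro!: sum.cong)
  then show ?thesis using assms by simp
qed

text \<open>Two pairings of indices survive: \<open>x' = x, y' = y\<close> gives the Hilbert-Schmidt
  norm of \<open>m\<close>, and \<open>x = y, x' = y'\<close> gives its trace. Their common part is
  counted twice, and dropping this nonnegative correction turns the identity into the bound.\<close>

lemma sum_phase_mult_cnj:
  "(\<Sum>j<3 ^ n. (cmod (\<Sum>x<n. \<Sum>y<n. phase n j x * cnj (phase n j y) * m x y))\<^sup>2)
    \<le> 3 ^ n * ((cmod (\<Sum>x<n. m x x))\<^sup>2 + (\<Sum>x<n. \<Sum>y<n. (cmod (m x y))\<^sup>2))" (is "?l \<le> ?r")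
proof -
  let ?K = "3 ^ n :: complex"
  have ind: "(\<Sum>j<3 ^ n. (phase n j x * cnj (phase n j y)) * cnj (phase n j x' * cnj (phase n j y'))) =
     ?K * of_bool (x' = x \<and> y' = y) + ?K * of_bool (x = y \<and> x' = y')
      - ?K * of_bool (x' = x \<and> y' = y \<and> x = y)"
    if "x < n" "y < n" "x' < n" "y' < n" for x y x' y'
    using sum_phase4[of x n y' y x'] that by (auto simp: mult_ac)
  have split: "a * (?K * b + ?K * c - ?K * d) = ?K * (a * b) + ?K * (a * c) - ?K * (a * d)" for a b c d
    by (simp add: algebra_simps)
  have "complex_of_real ?l = (\<Sum>x<n. \<Sum>y<n. \<Sum>x'<n. \<Sum>y'<n. m x y * cnj (m x' y') *
     (?K * of_bool (x' = x \<and> y' = y) + ?K * of_bool (x = y \<and> x' = y')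
      - ?K * of_bool (x' = x \<and> y' = y \<and> x = y)))"
    by (subst sum_cmod2_eq2) (intro sum.cong refl, subst ind, auto)
  also have "\<dots> = ?K * (\<Sum>x<n. \<Sum>y<n. \<Sum>x'<n. \<Sum>y'<n. m x y * cnj (m x' y') * of_bool (x' = x \<and> y' = y))
    + ?K * (\<Sum>x<n. \<Sum>y<n. \<Sum>x'<n. \<Sum>y'<n. m x y * cnj (m x' y') * of_bool (x = y \<and> x' = y'))
    - ?K * (\<Sum>x<n. \<Sum>y<n. \<Sum>x'<n. \<Sum>y'<n. m x y * cnj (m x' y') * of_bool (x' = x \<and> y' = y \<and> x = y))"
    by (simp only: split sum.distrib sum_subtractf sum_distrib_left)
  also have "(\<Sum>x<n. \<Sum>y<n. \<Sum>x'<n. \<Sum>y'<n. m x y * cnj (m x' y') * of_bool (x' = x \<and> y' = y)) =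
     complex_of_real (\<Sum>x<n. \<Sum>y<n. (cmod (m x y))\<^sup>2)"
    by (simp only: of_real_sum complex_norm_square) (intro sum.cong refl sum_delta_pair, auto)
  also have "(\<Sum>x<n. \<Sum>y<n. \<Sum>x'<n. \<Sum>y'<n. m x y * cnj (m x' y') * of_bool (x = y \<and> x' = y')) =
      complex_of_real ((cmod (\<Sum>x<n. m x x))\<^sup>2)"
  proof -
    have d: "(\<Sum>x<n. m x x) = (\<Sum>x<n. \<Sum>y<n. m x y * of_bool (x = y))"
      by (intro sum.cong refl) (simp add: of_bool_def if_distrib cong: if_cong)
    have "m x y * of_bool (x = y) * cnj (\<Sum>x<n. \<Sum>y<n. m x y * of_bool (x = y)) =
      (\<Sum>x'<n. \<Sum>y'<n. m x y * cnj (m x' y') * of_bool (x = y \<and> x' = y'))" for x y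
      unfolding cnj_sum sum_distrib_left by (intro sum.cong refl) simp
    then show ?thesis
      unfolding complex_norm_square d sum_distrib_right by (simp only:)
  qed
  also have "(\<Sum>x<n. \<Sum>y<n. \<Sum>x'<n. \<Sum>y'<n. m x y * cnj (m x' y') * of_bool (x' = x \<and> y' = y \<and> x = y)) =
     complex_of_real (\<Sum>x<n. \<Sum>y<n. (cmod (m x y))\<^sup>2 * of_bool (x = y))"
  proof -
    have "(\<Sum>x'<n. \<Sum>y'<n. m x y * cnj (m x' y') * of_bool (x' = x \<and> y' = y \<and> x = y)) =
      complex_of_real ((cmod (m x y))\<^sup>2 * of_bool (x = y))" if "x < n" "y < n" for x y
      using sum_delta_pair[OF that, of "\<lambda>x' y'. m x y * cnj (m x' y')"]
      by (cases "x = y") (simp_all del: of_bool_conj of_real_power, simp only: complex_norm_square)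
    then show ?thesis unfolding of_real_sum by (intro sum.cong refl) (simp only: lessThan_iff)
  qed
  finally have "complex_of_real ?l = complex_of_real (3 ^ n * (\<Sum>x<n. \<Sum>y<n. (cmod (m x y))\<^sup>2)
     + 3 ^ n * (cmod (\<Sum>x<n. m x x))\<^sup>2 - 3 ^ n * (\<Sum>x<n. \<Sum>y<n. (cmod (m x y))\<^sup>2 * of_bool (x = y)))" by simp
  then have "?l = 3 ^ n * (\<Sum>x<n. \<Sum>y<n. (cmod (m x y))\<^sup>2)
     + 3 ^ n * (cmod (\<Sum>x<n. m x x))\<^sup>2 - 3 ^ n * (\<Sum>x<n. \<Sum>y<n. (cmod (m x y))\<^sup>2 * of_bool (x = y))"
    by (simp only: of_real_eq_iff)
  moreover have "0 \<le> 3 ^ n * (\<Sum>x<n. \<Sum>y<n. (cmod (m x y))\<^sup>2 * of_bool (x = y))"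
    by (intro mult_nonneg_nonneg sum_nonneg) auto
  ultimately show ?thesis unfolding distrib_left by linarith
qed

text \<open>With both phases unconjugated the second surviving pairing is the exchange
  \<open>x' = y, y' = x\<close> instead of the trace. The product of an entry with the conjugate of
  its transposed entry is at most the mean of their squares, so this pairing costs one more
  Hilbert-Schmidt norm.\<close>

lemma sum_phase_mult:
  "(\<Sum>j<3 ^ n. (cmod (\<Sum>x<n. \<Sum>y<n. phase n j x * phase n j y * m x y))\<^sup>2)
    \<le> 3 ^ n * (2 * (\<Sum>x<n. \<Sum>y<n. (cmod (m x y))\<^sup>2))" (is "?l \<le> ?r")
proof -
  let ?K = "3 ^ n :: complex"
  have ind: "(\<Sum>j<3 ^ n. (phase n j x * phase n j y) * cnj (phase n j x' * phase n j y')) =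
     ?K * of_bool (x' = x \<and> y' = y) + ?K * of_bool (x' = y \<and> y' = x)
      - ?K * of_bool (x' = x \<and> y' = y \<and> x = y)"
    if "x < n" "y < n" "x' < n" "y' < n" for x y x' y'
    using sum_phase4[of x n y x' y'] that by auto
  have split: "a * (?K * b + ?K * c - ?K * d) = ?K * (a * b) + ?K * (a * c) - ?K * (a * d)" for a b c d
    by (simp add: algebra_simps)
  have "complex_of_real ?l = (\<Sum>x<n. \<Sum>y<n. \<Sum>x'<n. \<Sum>y'<n. m x y * cnj (m x' y') *
     (?K * of_bool (x' = x \<and> y' = y) + ?K * of_bool (x' = y \<and> y' = x)
      - ?K * of_bool (x' = x \<and> y' = y \<and> x = y)))"
    by (subst sum_cmod2_eq2) (intro sum.cong refl, subst ind, auto)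
  also have "\<dots> = ?K * (\<Sum>x<n. \<Sum>y<n. \<Sum>x'<n. \<Sum>y'<n. m x y * cnj (m x' y') * of_bool (x' = x \<and> y' = y))
    + ?K * (\<Sum>x<n. \<Sum>y<n. \<Sum>x'<n. \<Sum>y'<n. m x y * cnj (m x' y') * of_bool (x' = y \<and> y' = x))
    - ?K * (\<Sum>x<n. \<Sum>y<n. \<Sum>x'<n. \<Sum>y'<n. m x y * cnj (m x' y') * of_bool (x' = x \<and> y' = y \<and> x = y))"
    by (simp only: split sum.distrib sum_subtractf sum_distrib_left)
  also have "(\<Sum>x<n. \<Sum>y<n. \<Sum>x'<n. \<Sum>y'<n. m x y * cnj (m x' y') * of_bool (x' = x \<and> y' = y)) =
     complex_of_real (\<Sum>x<n. \<Sum>y<n. (cmod (m x y))\<^sup>2)"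
    by (simp only: of_real_sum complex_norm_square) (intro sum.cong refl sum_delta_pair, auto)
  also have "(\<Sum>x<n. \<Sum>y<n. \<Sum>x'<n. \<Sum>y'<n. m x y * cnj (m x' y') * of_bool (x' = y \<and> y' = x)) =
      (\<Sum>x<n. \<Sum>y<n. m x y * cnj (m y x))"
    by (intro sum.cong refl sum_delta_pair) auto
  also have "(\<Sum>x<n. \<Sum>y<n. \<Sum>x'<n. \<Sum>y'<n. m x y * cnj (m x' y') * of_bool (x' = x \<and> y' = y \<and> x = y)) =
     complex_of_real (\<Sum>x<n. \<Sum>y<n. (cmod (m x y))\<^sup>2 * of_bool (x = y))"
  proof -
    have "(\<Sum>x'<n. \<Sum>y'<n. m x y * cnj (m x' y') * of_bool (x' = x \<and> y' = y \<and> x = y)) =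
      complex_of_real ((cmod (m x y))\<^sup>2 * of_bool (x = y))" if "x < n" "y < n" for x y
      using sum_delta_pair[OF that, of "\<lambda>x' y'. m x y * cnj (m x' y')"]
      by (cases "x = y") (simp_all del: of_bool_conj of_real_power, simp only: complex_norm_square)
    then show ?thesis unfolding of_real_sum by (intro sum.cong refl) (simp only: lessThan_iff)
  qed
  \<comment> \<open>The exchange term is only given as a complex sum, so the identity is compared in
    real parts.\<close>
  finally have "Re (complex_of_real ?l) = Re (?K * complex_of_real (\<Sum>x<n. \<Sum>y<n. (cmod (m x y))\<^sup>2)
     + ?K * (\<Sum>x<n. \<Sum>y<n. m x y * cnj (m y x))
     - ?K * complex_of_real (\<Sum>x<n. \<Sum>y<n. (cmod (m x y))\<^sup>2 * of_bool (x = y)))"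
    by (rule arg_cong)
  moreover have ReK: "Re (?K * z) = 3 ^ n * Re z" for z
  proof -
    have "?K = complex_of_real (3 ^ n)" by simp
    then show ?thesis
      by (simp only: times_complex.sel Re_complex_of_real Im_complex_of_real mult_zero_left diff_zero)
  qed
  ultimately have l: "?l = 3 ^ n * (\<Sum>x<n. \<Sum>y<n. (cmod (m x y))\<^sup>2)
     + 3 ^ n * Re (\<Sum>x<n. \<Sum>y<n. m x y * cnj (m y x))
     - 3 ^ n * (\<Sum>x<n. \<Sum>y<n. (cmod (m x y))\<^sup>2 * of_bool (x = y))"
    by (simp only: ReK Re_complex_of_real plus_complex.sel minus_complex.sel)
  have "Re (\<Sum>x<n. \<Sum>y<n. m x y * cnj (m y x)) = (\<Sum>x<n. \<Sum>y<n. Re (m x y * cnj (m y x)))"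
    by (simp only: Re_sum)
  also have "\<dots> \<le> (\<Sum>x<n. \<Sum>y<n. ((cmod (m x y))\<^sup>2 + (cmod (m y x))\<^sup>2) / 2)"
  proof (intro sum_mono)
    fix x y
    have "Re (m x y * cnj (m y x)) \<le> cmod (m x y) * cmod (m y x)"
      by (metis complex_Re_le_cmod complex_mod_cnj norm_mult)
    also have "\<dots> \<le> ((cmod (m x y))\<^sup>2 + (cmod (m y x))\<^sup>2) / 2"
      using sum_squares_bound[of "cmod (m x y)" "cmod (m y x)"] by simp
    finally show "Re (m x y * cnj (m y x)) \<le> ((cmod (m x y))\<^sup>2 + (cmod (m y x))\<^sup>2) / 2" .
  qed
  also have "\<dots> = ((\<Sum>x<n. \<Sum>y<n. (cmod (m x y))\<^sup>2) + (\<Sum>x<n. \<Sum>y<n. (cmod (m y x))\<^sup>2)) / 2"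
    by (simp only: sum.distrib flip: sum_divide_distrib)
  also have "(\<Sum>x<n. \<Sum>y<n. (cmod (m y x))\<^sup>2) = (\<Sum>x<n. \<Sum>y<n. (cmod (m x y))\<^sup>2)" by (rule sum.swap)
  finally have "Re (\<Sum>x<n. \<Sum>y<n. m x y * cnj (m y x)) \<le> (\<Sum>x<n. \<Sum>y<n. (cmod (m x y))\<^sup>2)" by simp
  then have "3 ^ n * Re (\<Sum>x<n. \<Sum>y<n. m x y * cnj (m y x)) \<le> 3 ^ n * (\<Sum>x<n. \<Sum>y<n. (cmod (m x y))\<^sup>2)"
    by (rule mult_left_mono) simp
  moreover have "0 \<le> 3 ^ n * (\<Sum>x<n. \<Sum>y<n. (cmod (m x y))\<^sup>2 * of_bool (x = y))"
    by (intro mult_nonneg_nonneg sum_nonneg) auto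
  ultimately show ?thesis unfolding l mult_2 distrib_left by linarith
qed

section \<open>Averages over the scrambling unitaries\<close>

definition dft :: "nat \<Rightarrow> nat \<Rightarrow> nat \<Rightarrow> complex" where
  "dft n x y = cis (2 * pi * real x * real y / real n) / complex_of_real (sqrt (real n))"

lemma norm_dft: "0 < n \<Longrightarrow> (cmod (dft n x y))\<^sup>2 = 1 / real n"
  unfolding dft_def by (simp add: norm_divide power_divide)

lemma dft_unitary:
  assumes "x < n" "y < n"
  shows "(\<Sum>z<n. cnj (dft n z x) * dft n z y) = of_bool (x = y)"
proof -
  have n: "0 < n" using assms by simp
  have sq: "complex_of_real (sqrt (real n)) * complex_of_real (sqrt (real n)) = of_nat n"
    by (simp flip: of_real_mult)
  have "cnj (dft n z x) * dft n z y = cis (2 * pi * real z * real_of_int (int y - int x) / real n) / of_nat n" for z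
    unfolding dft_def
    by (simp add: cis_cnj cis_mult sq diff_divide_distrib algebra_simps)
  then have "(\<Sum>z<n. cnj (dft n z x) * dft n z y) =
     (\<Sum>z<n. cis (2 * pi * real z * real_of_int (int y - int x) / real n)) / of_nat n"
    by (simp only: sum_divide_distrib)
  also have "\<dots> = (if int n dvd int y - int x then of_nat n else 0) / of_nat n"
    by (simp only: sum_roots_of_unity[OF n])
  also have "int n dvd int y - int x \<longleftrightarrow> x = y"
    using assms zdvd_imp_le[of "int n" "int y - int x"] zdvd_imp_le[of "int n" "int x - int y"]
      dvd_diff_commute[of "int n" "int x" "int y"]
    by (cases x y rule: linorder_cases) auto
  finally show ?thesis using n by simp
qed

definition scrambler :: "nat \<Rightarrow> nat \<Rightarrow> nat \<Rightarrow> nat \<Rightarrow> nat \<Rightarrow> complex" where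
  "scrambler n j l y z = phase n j y * dft n y z * phase n l z"

lemma scrambler_unitary:
  assumes "x < n" "y < n"
  shows "(\<Sum>z<n. cnj (scrambler n j l z x) * scrambler n j l z y) = of_bool (x = y)"
proof -
  have "cnj (scrambler n j l z x) * scrambler n j l z y =
      (phase n j z * cnj (phase n j z)) * (cnj (phase n l x) * phase n l y) * (cnj (dft n z x) * dft n z y)" for z
    unfolding scrambler_def by (simp add: mult_ac)
  then have "(\<Sum>z<n. cnj (scrambler n j l z x) * scrambler n j l z y) =
      (cnj (phase n l x) * phase n l y) * (\<Sum>z<n. cnj (dft n z x) * dft n z y)"
    by (simp only: phase_unit mult_1 sum_distrib_left)
  then show ?thesis using dft_unitary[OF assms] phase_unit[of n l x]
    by (cases "x = y") (simp_all add: mult.commute)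
qed

lemma cmod_sum_mult_le:
  "(cmod (\<Sum>i\<in>I. a i * b i))\<^sup>2 \<le> (\<Sum>i\<in>I. (cmod (a i))\<^sup>2) * (\<Sum>i\<in>I. (cmod (b i))\<^sup>2)"
proof -
  have "(cmod (\<Sum>i\<in>I. a i * b i))\<^sup>2 \<le> (\<Sum>i\<in>I. cmod (a i) * cmod (b i))\<^sup>2"
    by (intro power_mono order.trans[OF norm_sum]) (simp_all add: norm_mult)
  also have "\<dots> \<le> (\<Sum>i\<in>I. (cmod (a i))\<^sup>2) * (\<Sum>i\<in>I. (cmod (b i))\<^sup>2)"
    by (rule Cauchy_Schwarz_ineq_sum)
  finally show ?thesis .
qed

lemma sum_swap3: "(\<Sum>l\<in>I. \<Sum>x\<in>J. \<Sum>y\<in>K. f l x y) = (\<Sum>x\<in>J. \<Sum>y\<in>K. \<Sum>l\<in>I. f l x y)"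
  by (subst sum.swap) (intro sum.cong refl sum.swap)

text \<open>The two phase families act on rows and columns separately and are each orthogonal, so
  nothing is lost; the factor 1/n is the squared modulus of a Fourier entry.\<close>

lemma sum_scrambler_linear:
  assumes n: "0 < n"
  shows "(\<Sum>j<3 ^ n. \<Sum>l<3 ^ n. (cmod (\<Sum>x<n. \<Sum>y<n. X x y * scrambler n j l y x))\<^sup>2) =
     3 ^ n * 3 ^ n * ((\<Sum>x<n. \<Sum>y<n. (cmod (X x y))\<^sup>2) / real n)"
proof -
  have "(\<Sum>x<n. \<Sum>y<n. X x y * scrambler n j l y x) =
     (\<Sum>y<n. phase n j y * (\<Sum>x<n. phase n l x * (X x y * dft n y x)))" for j l
    by (subst sum.swap) (simp add: scrambler_def sum_distrib_left mult_ac)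
  then have "(\<Sum>j<3 ^ n. \<Sum>l<3 ^ n. (cmod (\<Sum>x<n. \<Sum>y<n. X x y * scrambler n j l y x))\<^sup>2) =
     (\<Sum>l<3 ^ n. \<Sum>j<3 ^ n. (cmod (\<Sum>y<n. phase n j y * (\<Sum>x<n. phase n l x * (X x y * dft n y x))))\<^sup>2)"
    by (simp only:) (rule sum.swap)
  also have "\<dots> = (\<Sum>l<3 ^ n. 3 ^ n * (\<Sum>y<n. (cmod (\<Sum>x<n. phase n l x * (X x y * dft n y x)))\<^sup>2))"
    by (simp only: sum_phase_linear)
  also have "\<dots> = 3 ^ n * (\<Sum>y<n. \<Sum>l<3 ^ n. (cmod (\<Sum>x<n. phase n l x * (X x y * dft n y x)))\<^sup>2)"
    unfolding sum_distrib_left[symmetric] by (subst sum.swap) (rule refl)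
  also have "\<dots> = 3 ^ n * 3 ^ n * (\<Sum>y<n. \<Sum>x<n. (cmod (X x y))\<^sup>2 / real n)"
    unfolding sum_phase_linear sum_distrib_left[symmetric]
    by (simp add: norm_mult power_mult_distrib norm_dft[OF n])
  also have "(\<Sum>y<n. \<Sum>x<n. (cmod (X x y))\<^sup>2 / real n) = (\<Sum>x<n. \<Sum>y<n. (cmod (X x y))\<^sup>2) / real n"
    by (subst sum.swap) (simp only: sum_divide_distrib)
  finally show ?thesis .
qed

text \<open>The twisted block appears here as S Y S^T. The averages over \<open>j\<close> and
  \<open>l\<close> each cost a factor 2, which makes the 4, and the two Fourier entries contribute
  1/n^2.\<close>

lemma sum_scrambler_transpose:
  assumes n: "0 < n"
  shows "(\<Sum>j<3 ^ n. \<Sum>l<3 ^ n. (cmod (\<Sum>x<n. \<Sum>y<n. \<Sum>z<n. \<Sum>w<n.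
        P x y * scrambler n j l y z * Y z w * scrambler n j l x w))\<^sup>2) \<le>
     3 ^ n * 3 ^ n * (4 * (\<Sum>x<n. \<Sum>y<n. (cmod (P x y))\<^sup>2) * (\<Sum>z<n. \<Sum>w<n. (cmod (Y z w))\<^sup>2) / (real n)\<^sup>2)"
proof -
  \<comment> \<open>What remains once the row phases \<open>j\<close> are split off; it is again a
    quadratic expression in the column phases \<open>l\<close>.\<close>
  define m where "m l x y = (\<Sum>z<n. \<Sum>w<n. phase n l z * phase n l w * (P x y * dft n y z * Y z w * dft n x w))"
    for l x y
  have "(\<Sum>x<n. \<Sum>y<n. \<Sum>z<n. \<Sum>w<n. P x y * scrambler n j l y z * Y z w * scrambler n j l x w) =
    (\<Sum>x<n. \<Sum>y<n. phase n j x * phase n j y * m l x y)" for j l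
    unfolding m_def scrambler_def by (simp add: sum_distrib_left mult_ac)
  then have "(\<Sum>j<3 ^ n. \<Sum>l<3 ^ n. (cmod (\<Sum>x<n. \<Sum>y<n. \<Sum>z<n. \<Sum>w<n.
        P x y * scrambler n j l y z * Y z w * scrambler n j l x w))\<^sup>2) =
     (\<Sum>l<3 ^ n. \<Sum>j<3 ^ n. (cmod (\<Sum>x<n. \<Sum>y<n. phase n j x * phase n j y * m l x y))\<^sup>2)"
    by (simp only:) (rule sum.swap)
  also have "\<dots> \<le> (\<Sum>l<3 ^ n. 3 ^ n * (2 * (\<Sum>x<n. \<Sum>y<n. (cmod (m l x y))\<^sup>2)))"
    by (intro sum_mono sum_phase_mult)
  also have "\<dots> = 3 ^ n * (2 * (\<Sum>x<n. \<Sum>y<n. \<Sum>l<3 ^ n. (cmod (m l x y))\<^sup>2))"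
    unfolding sum_distrib_left[symmetric]
    by (subst sum_swap3) (rule refl)
  also have "\<dots> \<le> 3 ^ n * (2 * (\<Sum>x<n. \<Sum>y<n. 3 ^ n * (2 * (\<Sum>z<n. \<Sum>w<n. (cmod (P x y * dft n y z * Y z w * dft n x w))\<^sup>2))))"
    unfolding m_def by (intro mult_left_mono sum_mono sum_phase_mult) simp_all
  also have "\<dots> = 3 ^ n * 3 ^ n * (4 * (\<Sum>x<n. \<Sum>y<n. \<Sum>z<n. \<Sum>w<n. (cmod (P x y))\<^sup>2 * (cmod (Y z w))\<^sup>2 / (real n)\<^sup>2))"
    by (simp add: norm_mult power_mult_distrib norm_dft[OF n] sum_distrib_left mult_ac power2_eq_square[of "real n"])
  also have "(\<Sum>x<n. \<Sum>y<n. \<Sum>z<n. \<Sum>w<n. (cmod (P x y))\<^sup>2 * (cmod (Y z w))\<^sup>2 / (real n)\<^sup>2) =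
     (\<Sum>x<n. \<Sum>y<n. (cmod (P x y))\<^sup>2) * (\<Sum>z<n. \<Sum>w<n. (cmod (Y z w))\<^sup>2) / (real n)\<^sup>2"
    by (simp only: flip: sum_distrib_right sum_distrib_left sum_divide_distrib)
  finally show ?thesis by (simp only: mult.assoc times_divide_eq_right)
qed

text \<open>One scrambler is conjugated, so each of the two averages leaves a trace pairing and a
  Hilbert-Schmidt pairing. The resulting four terms are each at most \<open>?b\<close>, which is the
  origin of the 4.\<close>

lemma sum_scrambler_conjugate:
  assumes n: "0 < n"
  shows "(\<Sum>j<3 ^ n. \<Sum>l<3 ^ n. (cmod (\<Sum>y<n. \<Sum>w<n. \<Sum>z<n. \<Sum>x<n.
        P x y * scrambler n j l y z * Y z w * cnj (scrambler n j l w x)))\<^sup>2) \<le>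
     3 ^ n * 3 ^ n * (4 * (\<Sum>x<n. \<Sum>y<n. (cmod (P x y))\<^sup>2) * (\<Sum>z<n. \<Sum>w<n. (cmod (Y z w))\<^sup>2) / (real n)\<^sup>2)"
proof -
  define q where "q y w z x = P x y * dft n y z * Y z w * cnj (dft n w x)" for y w z x
  define m where "m l y w = (\<Sum>z<n. \<Sum>x<n. phase n l z * cnj (phase n l x) * q y w z x)"
    for l y w
  let ?P = "\<Sum>x<n. \<Sum>y<n. (cmod (P x y))\<^sup>2"
  let ?Y = "\<Sum>z<n. \<Sum>w<n. (cmod (Y z w))\<^sup>2"
  let ?b = "?P * ?Y / (real n)\<^sup>2"
  have q2: "(cmod (q y w z x))\<^sup>2 = (cmod (P x y))\<^sup>2 * (cmod (Y z w))\<^sup>2 / (real n)\<^sup>2" for y w z x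
    unfolding q_def by (simp add: norm_mult power_mult_distrib norm_dft[OF n] power2_eq_square[of "real n"])
  \<comment> \<open>Cauchy-Schwarz along an arbitrary family of index quadruples: the Fourier
    entries have constant modulus, so only the masses of \<open>P\<close> and \<open>Y\<close> on
    that family remain. The pairings that contain a trace differ only in which indices are
    identified.\<close>
  have cs: "(cmod (\<Sum>i\<in>I. q (y i) (w i) (z i) (x i)))\<^sup>2 \<le>
      (\<Sum>i\<in>I. (cmod (P (x i) (y i)))\<^sup>2) * (\<Sum>i\<in>I. (cmod (Y (z i) (w i)))\<^sup>2) / (real n)\<^sup>2"
    for I :: "'i set" and x y z w
  proof -
    have "(cmod (\<Sum>i\<in>I. q (y i) (w i) (z i) (x i)))\<^sup>2 =
       (cmod (\<Sum>i\<in>I. P (x i) (y i) * (dft n (y i) (z i) * Y (z i) (w i) * cnj (dft n (w i) (x i)))))\<^sup>2"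
      unfolding q_def by (simp only: mult.assoc)
    also have "\<dots> \<le> (\<Sum>i\<in>I. (cmod (P (x i) (y i)))\<^sup>2) *
        (\<Sum>i\<in>I. (cmod (dft n (y i) (z i) * Y (z i) (w i) * cnj (dft n (w i) (x i))))\<^sup>2)"
      by (rule cmod_sum_mult_le)
    also have "\<dots> = (\<Sum>i\<in>I. (cmod (P (x i) (y i)))\<^sup>2) * (\<Sum>i\<in>I. (cmod (Y (z i) (w i)))\<^sup>2) / (real n)\<^sup>2"
      by (simp add: norm_mult power_mult_distrib norm_dft[OF n] power2_eq_square[of "real n"] flip: sum_divide_distrib)
    finally show ?thesis .
  qed
  have "(\<Sum>y<n. \<Sum>w<n. \<Sum>z<n. \<Sum>x<n. P x y * scrambler n j l y z * Y z w * cnj (scrambler n j l w x)) =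
    (\<Sum>y<n. \<Sum>w<n. phase n j y * cnj (phase n j w) * m l y w)" for j l
    unfolding m_def scrambler_def q_def by (simp add: sum_distrib_left mult_ac)
  then have "(\<Sum>j<3 ^ n. \<Sum>l<3 ^ n. (cmod (\<Sum>y<n. \<Sum>w<n. \<Sum>z<n. \<Sum>x<n.
        P x y * scrambler n j l y z * Y z w * cnj (scrambler n j l w x)))\<^sup>2) =
     (\<Sum>l<3 ^ n. \<Sum>j<3 ^ n. (cmod (\<Sum>y<n. \<Sum>w<n. phase n j y * cnj (phase n j w) * m l y w))\<^sup>2)"
    by (simp only:) (rule sum.swap)
  also have "\<dots> \<le> (\<Sum>l<3 ^ n. 3 ^ n * ((cmod (\<Sum>y<n. m l y y))\<^sup>2 + (\<Sum>y<n. \<Sum>w<n. (cmod (m l y w))\<^sup>2)))"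
    by (intro sum_mono sum_phase_mult_cnj)
  also have "\<dots> = 3 ^ n * ((\<Sum>l<3 ^ n. (cmod (\<Sum>y<n. m l y y))\<^sup>2) + (\<Sum>y<n. \<Sum>w<n. \<Sum>l<3 ^ n. (cmod (m l y w))\<^sup>2))"
    unfolding sum_distrib_left[symmetric] sum.distrib
    by (subst sum_swap3) (rule refl)
  also have "\<dots> \<le> 3 ^ n * (3 ^ n * (2 * ?b) + 3 ^ n * (2 * ?b))"
  proof (intro mult_left_mono add_mono)
    have "(\<Sum>y<n. m l y y) = (\<Sum>z<n. \<Sum>x<n. phase n l z * cnj (phase n l x) * (\<Sum>y<n. q y y z x))" for l
      unfolding m_def sum_distrib_left
      by (subst sum.swap) (intro sum.cong refl sum.swap)
    then have "(\<Sum>l<3 ^ n. (cmod (\<Sum>y<n. m l y y))\<^sup>2) \<le>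
       3 ^ n * ((cmod (\<Sum>z<n. \<Sum>y<n. q y y z z))\<^sup>2 + (\<Sum>z<n. \<Sum>x<n. (cmod (\<Sum>y<n. q y y z x))\<^sup>2))"
      by (simp only:) (rule sum_phase_mult_cnj)
    also have "\<dots> \<le> 3 ^ n * (?b + ?b)"
    proof (intro mult_left_mono add_mono)
      show "(cmod (\<Sum>z<n. \<Sum>y<n. q y y z z))\<^sup>2 \<le> ?b"
        using cs[of "\<lambda>i. snd i" "\<lambda>i. snd i" "\<lambda>i. fst i" "\<lambda>i. fst i" "{..<n} \<times> {..<n}"]
        by (simp only: sum.cartesian_product' fst_conv snd_conv)
      have "(\<Sum>z<n. \<Sum>x<n. (cmod (\<Sum>y<n. q y y z x))\<^sup>2) \<le>
        (\<Sum>z<n. \<Sum>x<n. (\<Sum>y<n. (cmod (P x y))\<^sup>2) * (\<Sum>y<n. (cmod (Y z y))\<^sup>2) / (real n)\<^sup>2)"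
        by (intro sum_mono cs)
      also have "\<dots> = ?b"
        by (subst sum.swap) (simp only: sum_product sum_divide_distrib flip: sum_distrib_right)
      finally show "(\<Sum>z<n. \<Sum>x<n. (cmod (\<Sum>y<n. q y y z x))\<^sup>2) \<le> ?b" .
    qed simp
    finally show "(\<Sum>l<3 ^ n. (cmod (\<Sum>y<n. m l y y))\<^sup>2) \<le> 3 ^ n * (2 * ?b)" by simp
    have "(\<Sum>y<n. \<Sum>w<n. \<Sum>l<3 ^ n. (cmod (m l y w))\<^sup>2) \<le>
       (\<Sum>y<n. \<Sum>w<n. 3 ^ n * ((cmod (\<Sum>z<n. q y w z z))\<^sup>2 + (\<Sum>z<n. \<Sum>x<n. (cmod (q y w z x))\<^sup>2)))"
      unfolding m_def by (intro sum_mono sum_phase_mult_cnj)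
    also have "\<dots> \<le> (\<Sum>y<n. \<Sum>w<n. 3 ^ n * (2 * ((\<Sum>x<n. (cmod (P x y))\<^sup>2) * (\<Sum>z<n. (cmod (Y z w))\<^sup>2) / (real n)\<^sup>2)))"
    proof (intro sum_mono mult_left_mono)
      fix y w
      have "(\<Sum>z<n. \<Sum>x<n. (cmod (q y w z x))\<^sup>2) = (\<Sum>x<n. (cmod (P x y))\<^sup>2) * (\<Sum>z<n. (cmod (Y z w))\<^sup>2) / (real n)\<^sup>2"
        unfolding q2 by (subst sum.swap) (simp only: sum_product sum_divide_distrib)
      moreover have "(cmod (\<Sum>z<n. q y w z z))\<^sup>2 \<le> (\<Sum>x<n. (cmod (P x y))\<^sup>2) * (\<Sum>z<n. (cmod (Y z w))\<^sup>2) / (real n)\<^sup>2"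
        by (rule cs)
      ultimately show "(cmod (\<Sum>z<n. q y w z z))\<^sup>2 + (\<Sum>z<n. \<Sum>x<n. (cmod (q y w z x))\<^sup>2) \<le>
        2 * ((\<Sum>x<n. (cmod (P x y))\<^sup>2) * (\<Sum>z<n. (cmod (Y z w))\<^sup>2) / (real n)\<^sup>2)" by linarith
    qed simp
    also have "\<dots> = 3 ^ n * (2 * ((\<Sum>y<n. \<Sum>x<n. (cmod (P x y))\<^sup>2) * (\<Sum>w<n. \<Sum>z<n. (cmod (Y z w))\<^sup>2) / (real n)\<^sup>2))"
      by (simp only: flip: sum_distrib_right sum_distrib_left sum_divide_distrib)
    also have "\<dots> = 3 ^ n * (2 * ?b)"
      by (subst sum.swap, subst (2) sum.swap) (rule refl)
    finally show "(\<Sum>y<n. \<Sum>w<n. \<Sum>l<3 ^ n. (cmod (m l y w))\<^sup>2) \<le> 3 ^ n * (2 * ?b)" .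
  qed simp
  also have "\<dots> = 3 ^ n * 3 ^ n * (4 * ?P * ?Y / (real n)\<^sup>2)" by (simp add: mult_ac)
  finally show ?thesis .
qed

section \<open>Overlaps of blocks\<close>

text \<open>For two rows of V this is an entry of V A V^T. It is bilinear and not sesquilinear
  because both tensor factors carry the same V, with no conjugate.\<close>

definition bil :: "nat \<Rightarrow> (nat \<Rightarrow> nat \<Rightarrow> complex) \<Rightarrow> (nat \<Rightarrow> complex) \<Rightarrow> (nat \<Rightarrow> complex) \<Rightarrow> complex" where
  "bil d A f g = (\<Sum>i<d. \<Sum>j<d. A i j * f i * g j)"

lemma bil_sum_left: "bil d A (\<lambda>i. \<Sum>q\<in>Q. v q * f q i) g = (\<Sum>q\<in>Q. v q * bil d A (f q) g)"
proof -
  have "bil d A (\<lambda>i. \<Sum>q\<in>Q. v q * f q i) g = (\<Sum>i<d. \<Sum>j<d. \<Sum>q\<in>Q. v q * (A i j * f q i * g j))"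
    unfolding bil_def by (simp add: sum_distrib_left sum_distrib_right mult_ac)
  also have "\<dots> = (\<Sum>q\<in>Q. \<Sum>i<d. \<Sum>j<d. v q * (A i j * f q i * g j))"
    by (subst sum.swap[of _ Q]) (intro sum.cong refl sum.swap)
  finally show ?thesis unfolding bil_def by (simp only: sum_distrib_left)
qed

lemma bil_transpose: "bil d (\<lambda>i j. A j i) f g = bil d A g f"
  unfolding bil_def by (subst sum.swap) (simp add: mult_ac)

lemma bil_sum_right: "bil d A f (\<lambda>i. \<Sum>q\<in>Q. v q * g q i) = (\<Sum>q\<in>Q. v q * bil d A f (g q))"
  using bil_sum_left[of d "\<lambda>i j. A j i"] by (simp only: bil_transpose[of d A])

text \<open>\<open>r a b\<close> is the row of the random unitary indexed by the basis vector \<open>e\<^sub>a \<otimes> e\<^sub>b\<close> of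
  \<open>\<complex>\<^sup>k \<otimes> \<complex>\<^sup>n\<close>, so \<open>overlap\<close> is the Hilbert-Schmidt product of the blocks \<open>(a, a')\<close> and \<open>(c, c')\<close>
  of \<open>V A V\<^sup>T\<close>; these products are the entries of the channel output.\<close>
definition overlap :: "nat \<Rightarrow> nat \<Rightarrow> (nat \<Rightarrow> nat \<Rightarrow> complex) \<Rightarrow> (nat \<Rightarrow> nat \<Rightarrow> nat \<Rightarrow> complex) \<Rightarrow>
    nat \<Rightarrow> nat \<Rightarrow> nat \<Rightarrow> nat \<Rightarrow> complex" where
  "overlap n d A r a a' c c' =
     (\<Sum>b<n. \<Sum>b'<n. bil d A (r a b) (r a' b') * cnj (bil d A (r c b) (r c' b')))"

lemma overlap_swap: "overlap n d A r a a' c c' = cnj (overlap n d A r c c' a a')"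
  unfolding overlap_def by (simp add: mult.commute)

text \<open>Transposing \<open>A\<close> exchanges the two tensor factors, so statements about first
  indices carry over to second indices.\<close>

lemma overlap_transpose: "overlap n d (\<lambda>i j. A j i) r a a' c c' = overlap n d A r a' a c' c"
  unfolding overlap_def bil_transpose[of d A] by (rule sum.swap)

text \<open>The effect on the rows of left multiplication by a block-diagonal matrix. Working with
  rows lets the bilinearity of \<open>bil\<close> pull \<open>v\<close> out of an overlap
  directly.\<close>

definition twist :: "nat \<Rightarrow> nat \<Rightarrow> (nat \<Rightarrow> nat \<Rightarrow> complex) \<Rightarrow> (nat \<Rightarrow> nat \<Rightarrow> nat \<Rightarrow> complex) \<Rightarrow>
    nat \<Rightarrow> nat \<Rightarrow> nat \<Rightarrow> complex" where
  "twist n c v r a b = (if a = c then (\<lambda>i. \<Sum>q<n. v b q * r c q i) else r a b)"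

lemma overlap_twist_linear:
  assumes "a \<noteq> c" "a' \<noteq> c" "c' \<noteq> c"
  shows "cmod (overlap n d A (twist n c v r) a a' c c') =
    cmod (\<Sum>x<n. \<Sum>y<n. (\<Sum>b'<n. cnj (bil d A (r a y) (r a' b')) * bil d A (r c x) (r c' b')) * v y x)"
proof -
  \<comment> \<open>The twisted row stands in the conjugated factor; passing to the conjugate, with
    the same modulus, makes \<open>v\<close> appear unconjugated.\<close>
  have "cnj (overlap n d A (twist n c v r) a a' c c') =
      (\<Sum>b<n. \<Sum>b'<n. cnj (bil d A (r a b) (r a' b')) * (\<Sum>q<n. v b q * bil d A (r c q) (r c' b')))"
    using assms unfolding overlap_def twist_def by (simp add: bil_sum_left)
  also have "\<dots> = (\<Sum>b<n. \<Sum>b'<n. \<Sum>q<n. cnj (bil d A (r a b) (r a' b')) * bil d A (r c q) (r c' b') * v b q)"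
    by (simp add: sum_distrib_left mult_ac)
  also have "\<dots> = (\<Sum>b<n. \<Sum>q<n. \<Sum>b'<n. cnj (bil d A (r a b) (r a' b')) * bil d A (r c q) (r c' b') * v b q)"
    by (intro sum.cong refl sum.swap)
  also have "\<dots> = (\<Sum>x<n. \<Sum>y<n. (\<Sum>b'<n. cnj (bil d A (r a y) (r a' b')) * bil d A (r c x) (r c' b')) * v y x)"
    by (subst sum.swap) (simp only: sum_distrib_right)
  finally show ?thesis by (metis complex_mod_cnj)
qed

lemma overlap_twist_transpose:
  assumes "a \<noteq> c" "a' \<noteq> c"
  shows "cmod (overlap n d A (twist n c v r) a a' c c) =
    cmod (\<Sum>x<n. \<Sum>y<n. \<Sum>z<n. \<Sum>w<n.
      cnj (bil d A (r a x) (r a' y)) * v y z * bil d A (r c w) (r c z) * v x w)"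
proof -
  have "cnj (overlap n d A (twist n c v r) a a' c c) =
      (\<Sum>x<n. \<Sum>y<n. cnj (bil d A (r a x) (r a' y)) * (\<Sum>w<n. v x w * (\<Sum>z<n. v y z * bil d A (r c w) (r c z))))"
    using assms unfolding overlap_def twist_def
    by (simp add: bil_sum_left bil_sum_right)
  also have "\<dots> = (\<Sum>x<n. \<Sum>y<n. \<Sum>w<n. \<Sum>z<n.
      cnj (bil d A (r a x) (r a' y)) * v y z * bil d A (r c w) (r c z) * v x w)"
    by (simp add: sum_distrib_left mult_ac)
  also have "\<dots> = (\<Sum>x<n. \<Sum>y<n. \<Sum>z<n. \<Sum>w<n.
      cnj (bil d A (r a x) (r a' y)) * v y z * bil d A (r c w) (r c z) * v x w)"
    by (intro sum.cong refl sum.swap)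
  finally show ?thesis by (metis complex_mod_cnj)
qed

lemma overlap_twist_conjugate:
  assumes "a \<noteq> c" "c' \<noteq> c"
  shows "overlap n d A (twist n c v r) a c c c' =
    (\<Sum>y<n. \<Sum>w<n. \<Sum>z<n. \<Sum>x<n.
      cnj (bil d A (r c x) (r c' y)) * v y z * bil d A (r a w) (r c z) * cnj (v w x))"
proof -
  have "overlap n d A (twist n c v r) a c c c' =
      (\<Sum>w<n. \<Sum>y<n. (\<Sum>z<n. v y z * bil d A (r a w) (r c z)) * (\<Sum>x<n. cnj (v w x) * cnj (bil d A (r c x) (r c' y))))"
    using assms unfolding overlap_def twist_def
    by (simp add: bil_sum_left bil_sum_right)
  also have "\<dots> = (\<Sum>y<n. \<Sum>w<n. (\<Sum>z<n. v y z * bil d A (r a w) (r c z)) * (\<Sum>x<n. cnj (v w x) * cnj (bil d A (r c x) (r c' y))))"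
    by (rule sum.swap)
  finally show ?thesis by (simp add: sum_product mult_ac)
qed

text \<open>As \<open>a\<close> differs from \<open>c\<close>, the twisted index sits in the third
  slot and in at most one of the slots \<open>a'\<close> and \<open>c'\<close>. A single occurrence
  is linear in the scrambler. A second one on the same side gives S Y S^T, on the other side a
  scrambler and a conjugated scrambler. Three occurrences are excluded because the phases are
  controlled only up to fourth moments.\<close>

lemma sum_overlap_twist:
  fixes \<kappa> :: real
  assumes n: "0 < n" and ac: "a \<noteq> c" "\<not> (a' = c \<and> c' = c)"
    and k: "a < k" "a' < k" "c < k" "c' < k"
    and hs: "\<And>a a'. a < k \<Longrightarrow> a' < k \<Longrightarrow> (\<Sum>b<n. \<Sum>b'<n. (cmod (bil d A (r a b) (r a' b')))\<^sup>2) \<le> 1"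
    and op: "\<And>a a' v. a < k \<Longrightarrow> a' < k \<Longrightarrow>
      (\<Sum>b<n. (cmod (\<Sum>b'<n. bil d A (r a b) (r a' b') * v b'))\<^sup>2) \<le> \<kappa>\<^sup>2 * (\<Sum>b'<n. (cmod (v b'))\<^sup>2)"
  shows "(\<Sum>j<3 ^ n. \<Sum>l<3 ^ n. (cmod (overlap n d A (twist n c (scrambler n j l) r) a a' c c'))\<^sup>2)
     \<le> 3 ^ n * 3 ^ n * (4 / (real n)\<^sup>2 + \<kappa>\<^sup>2 / real n)"
proof -
  have prod1: "4 * x * y / (real n)\<^sup>2 \<le> 4 / (real n)\<^sup>2 + \<kappa>\<^sup>2 / real n" if "0 \<le> x" "x \<le> 1" "0 \<le> y" "y \<le> 1" for x y :: real
  proof -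
    have "x * y \<le> 1" using that by (simp add: mult_le_one)
    then have "4 * x * y / (real n)\<^sup>2 \<le> 4 / (real n)\<^sup>2" by (intro divide_right_mono) auto
    then show ?thesis by (smt (verit) divide_nonneg_nonneg of_nat_0_le_iff zero_le_power2)
  qed
  have sw: "(\<Sum>z<n. \<Sum>w<n. (cmod (bil d A (r p w) (r q z)))\<^sup>2) = (\<Sum>b<n. \<Sum>b'<n. (cmod (bil d A (r p b) (r q b')))\<^sup>2)" for p q
    by (rule sum.swap)
  consider (lin) "a' \<noteq> c" "c' \<noteq> c" | (tr) "a' \<noteq> c" "c' = c" | (cj) "a' = c" "c' \<noteq> c"
    using ac by blast
  then show ?thesis
  proof cases
    case lin
    \<comment> \<open>Up to conjugation a product of two blocks: one has operator norm at most
      \<kappa>, the other Hilbert-Schmidt norm at most 1, so the squared Hilbert-Schmidt norm is at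
      most \<kappa> squared.\<close>
    let ?X = "\<lambda>x y. \<Sum>b'<n. cnj (bil d A (r a y) (r a' b')) * bil d A (r c x) (r c' b')"
    have X: "(\<Sum>y<n. (cmod (?X x y))\<^sup>2) \<le> \<kappa>\<^sup>2 * (\<Sum>b'<n. (cmod (bil d A (r c x) (r c' b')))\<^sup>2)" for x
    proof -
      have "(cmod (?X x y))\<^sup>2 = (cmod (\<Sum>b'<n. bil d A (r a y) (r a' b') * cnj (bil d A (r c x) (r c' b'))))\<^sup>2" for y
      proof -
        have "?X x y = cnj (\<Sum>b'<n. bil d A (r a y) (r a' b') * cnj (bil d A (r c x) (r c' b')))" by simp
        then show ?thesis by (simp only: complex_mod_cnj)
      qed
      then show ?thesis using op[OF k(1,2), of "\<lambda>b'. cnj (bil d A (r c x) (r c' b'))"] by simp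
    qed
    have "(\<Sum>x<n. \<Sum>y<n. (cmod (?X x y))\<^sup>2) \<le> \<kappa>\<^sup>2 * (\<Sum>x<n. \<Sum>b'<n. (cmod (bil d A (r c x) (r c' b')))\<^sup>2)"
      by (subst sum_distrib_left) (rule sum_mono, rule X)
    also have "\<dots> \<le> \<kappa>\<^sup>2 * 1" by (intro mult_left_mono hs k) auto
    finally have "(\<Sum>x<n. \<Sum>y<n. (cmod (?X x y))\<^sup>2) / real n \<le> 4 / (real n)\<^sup>2 + \<kappa>\<^sup>2 / real n"
      by (smt (verit) divide_nonneg_nonneg divide_right_mono of_nat_0_le_iff zero_le_power2)
    then show ?thesis
      unfolding overlap_twist_linear[OF ac(1) lin] sum_scrambler_linear[OF n] by (intro mult_left_mono) auto
  next
    case tr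
    have "(\<Sum>j<3 ^ n. \<Sum>l<3 ^ n. (cmod (overlap n d A (twist n c (scrambler n j l) r) a a' c c'))\<^sup>2) \<le>
        3 ^ n * 3 ^ n * (4 * (\<Sum>x<n. \<Sum>y<n. (cmod (cnj (bil d A (r a x) (r a' y))))\<^sup>2) *
           (\<Sum>z<n. \<Sum>w<n. (cmod (bil d A (r c w) (r c z)))\<^sup>2) / (real n)\<^sup>2)"
      unfolding tr(2) overlap_twist_transpose[OF ac(1) tr(1)] by (rule sum_scrambler_transpose[OF n])
    also have "\<dots> \<le> 3 ^ n * 3 ^ n * (4 / (real n)\<^sup>2 + \<kappa>\<^sup>2 / real n)"
      unfolding sw complex_mod_cnj by (intro mult_left_mono prod1 hs k sum_nonneg) auto
    finally show ?thesis .
  next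
    case cj
    have "(\<Sum>j<3 ^ n. \<Sum>l<3 ^ n. (cmod (overlap n d A (twist n c (scrambler n j l) r) a a' c c'))\<^sup>2) \<le>
        3 ^ n * 3 ^ n * (4 * (\<Sum>x<n. \<Sum>y<n. (cmod (cnj (bil d A (r c x) (r c' y))))\<^sup>2) *
           (\<Sum>z<n. \<Sum>w<n. (cmod (bil d A (r a w) (r c z)))\<^sup>2) / (real n)\<^sup>2)"
      unfolding cj(1) overlap_twist_conjugate[OF ac(1) cj(2)] by (rule sum_scrambler_conjugate[OF n])
    also have "\<dots> \<le> 3 ^ n * 3 ^ n * (4 / (real n)\<^sup>2 + \<kappa>\<^sup>2 / real n)"
      unfolding sw complex_mod_cnj by (intro mult_left_mono prod1 hs k sum_nonneg) auto
    finally show ?thesis .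
  qed
qed

text \<open>Rotating \<open>\<complex>\<^sup>k\<close> by a unitary with entries of modulus \<open>1 / \<surd>k\<close> turns each diagonal entry of
  the output into the average of all diagonal entries plus a combination of off-diagonal ones.\<close>
lemma overlap_rotate_diag:
  assumes k: "0 < k"
    and tr: "(\<Sum>s\<in>{..<k} \<times> {..<k}. overlap n d A r (fst s) (snd s) (fst s) (snd s)) = 1"
  shows "(cmod (overlap n d A (\<lambda>a b i. \<Sum>p<k. dft k a p * r p b i) a a' a a' - 1 / (of_nat k)\<^sup>2))\<^sup>2 \<le>
    (\<Sum>s\<in>{..<k} \<times> {..<k}. \<Sum>s'\<in>{..<k} \<times> {..<k}.
      if s = s' then 0 else (cmod (overlap n d A r (fst s) (snd s) (fst s') (snd s')))\<^sup>2)"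
    (is "(cmod (?L - _))\<^sup>2 \<le> _")
proof -
  let ?I = "{..<k} \<times> {..<k}"
  let ?N = "{..<n} \<times> {..<n}"
  define ov where "ov s s' = overlap n d A r (fst s) (snd s) (fst s') (snd s')" for s s'
  define f where "f s = dft k a (fst s) * dft k a' (snd s)" for s
  define B where "B b s = bil d A (r (fst s) (fst b)) (r (snd s) (snd b))" for b s
  have f2: "(cmod (f s))\<^sup>2 = 1 / (real k)\<^sup>2" for s
    unfolding f_def by (simp add: norm_mult power_mult_distrib norm_dft[OF k] power2_eq_square[of "real k"])
  have ff: "f s * cnj (f s) = 1 / (of_nat k)\<^sup>2" for s
    using f2[of s] complex_norm_square[of "f s"] by simp
  have ov: "ov s s' = (\<Sum>b\<in>?N. B b s * cnj (B b s'))" for s s'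
    unfolding ov_def overlap_def B_def sum.cartesian_product' fst_conv snd_conv ..
  have "?L = (\<Sum>b\<in>?N. (\<Sum>s\<in>?I. f s * B b s) * cnj (\<Sum>s\<in>?I. f s * B b s))"
    unfolding overlap_def f_def B_def sum.cartesian_product' fst_conv snd_conv
    by (simp only: bil_sum_left bil_sum_right sum_distrib_left mult.assoc)
  also have "\<dots> = (\<Sum>b\<in>?N. \<Sum>s\<in>?I. \<Sum>s'\<in>?I. f s * cnj (f s') * (B b s * cnj (B b s')))"
    unfolding cnj_sum sum_product by (simp add: mult_ac)
  also have "\<dots> = (\<Sum>s\<in>?I. \<Sum>s'\<in>?I. f s * cnj (f s') * ov s s')"
    unfolding ov sum_distrib_left by (rule sum_swap3)
  also have "\<dots> = (\<Sum>s\<in>?I. \<Sum>s'\<in>?I. (if s = s' then 1 / (of_nat k)\<^sup>2 * ov s s' else 0) +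
        f s * cnj (f s') * (if s = s' then 0 else ov s s'))"
    by (intro sum.cong refl) (simp add: ff)
  also have "\<dots> = (\<Sum>s\<in>?I. 1 / (of_nat k)\<^sup>2 * ov s s) +
      (\<Sum>s\<in>?I. \<Sum>s'\<in>?I. f s * cnj (f s') * (if s = s' then 0 else ov s s'))"
    by (simp add: sum.distrib cong: if_cong)
  also have "(\<Sum>s\<in>?I. 1 / (of_nat k)\<^sup>2 * ov s s) = 1 / (of_nat k)\<^sup>2"
    unfolding sum_distrib_left[symmetric] using tr by (simp add: ov_def)
  finally have "?L - 1 / (of_nat k)\<^sup>2 = (\<Sum>s\<in>?I. \<Sum>s'\<in>?I. f s * cnj (f s') * (if s = s' then 0 else ov s s'))"
    by simp
  also have "\<dots> = (\<Sum>t\<in>?I \<times> ?I. f (fst t) * cnj (f (snd t)) * (if fst t = snd t then 0 else ov (fst t) (snd t)))"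
    by (subst sum.cartesian_product) (simp only: case_prod_unfold)
  finally have "(cmod (?L - 1 / (of_nat k)\<^sup>2))\<^sup>2 \<le> (\<Sum>t\<in>?I \<times> ?I. (cmod (f (fst t) * cnj (f (snd t))))\<^sup>2) *
      (\<Sum>t\<in>?I \<times> ?I. (cmod (if fst t = snd t then 0 else ov (fst t) (snd t)))\<^sup>2)"
    by (simp only: cmod_sum_mult_le)
  \<comment> \<open>There are k^4 pairs, each of weight k^(-4), so Cauchy-Schwarz costs no
    constant.\<close>
  also have "(\<Sum>t\<in>?I \<times> ?I. (cmod (f (fst t) * cnj (f (snd t))))\<^sup>2) = 1"
    using k unfolding norm_mult power_mult_distrib complex_mod_cnj f2 by (simp add: power2_eq_square)
  also have "(\<Sum>t\<in>?I \<times> ?I. (cmod (if fst t = snd t then 0 else ov (fst t) (snd t)))\<^sup>2) =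
      (\<Sum>s\<in>?I. \<Sum>s'\<in>?I. (cmod (if s = s' then 0 else ov s s'))\<^sup>2)"
    by (subst sum.cartesian_product) (simp only: case_prod_unfold)
  also have "\<dots> = (\<Sum>s\<in>?I. \<Sum>s'\<in>?I. if s = s' then 0 else (cmod (ov s s'))\<^sup>2)"
    by (intro sum.cong refl) simp
  finally show ?thesis unfolding ov_def by simp
qed

section \<open>Unitaries on the tensor product\<close>

text \<open>An operator norm bound written with squared sums, a form that passes directly to
  transposes, products and blocks.\<close>

definition contracts :: "nat \<Rightarrow> nat \<Rightarrow> (nat \<Rightarrow> nat \<Rightarrow> complex) \<Rightarrow> real \<Rightarrow> bool" where
  "contracts N M B \<kappa> \<longleftrightarrow> (\<forall>v. (\<Sum>x<N. (cmod (\<Sum>y<M. B x y * v y))\<^sup>2) \<le> \<kappa>\<^sup>2 * (\<Sum>y<M. (cmod (v y))\<^sup>2))"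

text \<open>Duality: with \<open>s\<close> the image of \<open>v\<close> under the transpose,
  \<open>S\<close> is a pairing of \<open>v\<close> with the image of the conjugate of
  \<open>s\<close> under \<open>B\<close>. Cauchy-Schwarz bounds \<open>S * S\<close> by
  \<open>S\<close> times the claimed bound, and one factor \<open>S\<close> cancels.\<close>

lemma contracts_transpose:
  assumes "contracts N M B \<kappa>"
  shows "contracts M N (\<lambda>y x. B x y) \<kappa>"
  unfolding contracts_def
proof
  fix v
  define s where "s y = (\<Sum>x<N. B x y * v x)" for y
  define S where "S = (\<Sum>y<M. (cmod (s y))\<^sup>2)"
  have S0: "0 \<le> S" unfolding S_def by (simp add: sum_nonneg)
  have "complex_of_real S = (\<Sum>y<M. s y * cnj (s y))"
    unfolding S_def by (simp only: of_real_sum complex_norm_square)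
  also have "\<dots> = (\<Sum>y<M. \<Sum>x<N. B x y * v x * cnj (s y))"
    by (subst (1) s_def) (simp only: sum_distrib_right)
  also have "\<dots> = (\<Sum>x<N. v x * (\<Sum>y<M. B x y * cnj (s y)))"
    by (subst sum.swap) (simp add: sum_distrib_left mult_ac)
  finally have eq: "complex_of_real S = (\<Sum>x<N. v x * (\<Sum>y<M. B x y * cnj (s y)))" .
  have "S\<^sup>2 = (cmod (complex_of_real S))\<^sup>2" by simp
  also have "\<dots> \<le> (\<Sum>x<N. (cmod (v x))\<^sup>2) * (\<Sum>x<N. (cmod (\<Sum>y<M. B x y * cnj (s y)))\<^sup>2)"
    unfolding eq by (rule cmod_sum_mult_le)
  also have "\<dots> \<le> (\<Sum>x<N. (cmod (v x))\<^sup>2) * (\<kappa>\<^sup>2 * (\<Sum>y<M. (cmod (cnj (s y)))\<^sup>2))"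
    by (intro mult_left_mono sum_nonneg assms[unfolded contracts_def, rule_format]) auto
  finally have "S * S \<le> \<kappa>\<^sup>2 * (\<Sum>x<N. (cmod (v x))\<^sup>2) * S"
    unfolding complex_mod_cnj S_def[symmetric] by (simp add: power2_eq_square mult_ac)
  then have "S \<le> \<kappa>\<^sup>2 * (\<Sum>x<N. (cmod (v x))\<^sup>2)"
    using S0 by (cases "S = 0") (auto simp: sum_nonneg)
  then show "(\<Sum>y<M. (cmod (\<Sum>x<N. B x y * v x))\<^sup>2) \<le> \<kappa>\<^sup>2 * (\<Sum>x<N. (cmod (v x))\<^sup>2)"
    unfolding S_def s_def .
qed

lemma isometry_norm:
  fixes u :: "nat \<Rightarrow> nat \<Rightarrow> complex"
  assumes iso: "\<And>i j. i < d \<Longrightarrow> j < d \<Longrightarrow> (\<Sum>x<N. cnj (u x i) * u x j) = of_bool (i = j)"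
  shows "(\<Sum>x<N. (cmod (\<Sum>i<d. u x i * v i))\<^sup>2) = (\<Sum>i<d. (cmod (v i))\<^sup>2)"
proof -
  have "complex_of_real (\<Sum>x<N. (cmod (\<Sum>i<d. u x i * v i))\<^sup>2) =
     (\<Sum>i<d. \<Sum>j<d. v i * cnj (v j) * (\<Sum>x<N. u x i * cnj (u x j)))"
    by (rule sum_cmod2_eq)
  also have "\<dots> = (\<Sum>i<d. \<Sum>j<d. if i = j then v i * cnj (v j) else 0)"
  proof (intro sum.cong refl)
    fix i j assume ij: "i \<in> {..<d}" "j \<in> {..<d}"
    have "(\<Sum>x<N. u x i * cnj (u x j)) = of_bool (i = j)"
      using iso[of j i] ij by (auto simp: mult.commute)
    then show "v i * cnj (v j) * (\<Sum>x<N. u x i * cnj (u x j)) = (if i = j then v i * cnj (v j) else 0)"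
      by simp
  qed
  also have "\<dots> = (\<Sum>i<d. v i * cnj (v i))" by simp
  also have "\<dots> = complex_of_real (\<Sum>i<d. (cmod (v i))\<^sup>2)"
    by (simp only: of_real_sum complex_norm_square)
  finally show ?thesis by (simp only: of_real_eq_iff)
qed

lemma bil_alt: "bil d A f g = (\<Sum>j<d. g j * (\<Sum>i<d. f i * A i j))"
  unfolding bil_def by (subst sum.swap) (simp add: sum_distrib_left mult_ac)

lemma bil_alt2: "bil d A f g = (\<Sum>i<d. f i * (\<Sum>j<d. A i j * g j))"
  unfolding bil_def by (simp add: sum_distrib_left mult_ac)

text \<open>The Hilbert-Schmidt norm of V A V^T is computed by removing the isometry first on the
  right, then on the left.\<close>

lemma bil_isometry_norm:
  fixes u :: "nat \<Rightarrow> nat \<Rightarrow> complex"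
  assumes iso: "\<And>i j. i < d \<Longrightarrow> j < d \<Longrightarrow> (\<Sum>x<N. cnj (u x i) * u x j) = of_bool (i = j)"
  shows "(\<Sum>x<N. \<Sum>y<N. (cmod (bil d A (u x) (u y)))\<^sup>2) = (\<Sum>i<d. \<Sum>j<d. (cmod (A i j))\<^sup>2)"
proof -
  have "(\<Sum>x<N. \<Sum>y<N. (cmod (bil d A (u x) (u y)))\<^sup>2) = (\<Sum>x<N. \<Sum>j<d. (cmod (\<Sum>i<d. u x i * A i j))\<^sup>2)"
    unfolding bil_alt by (simp only: isometry_norm[OF iso])
  also have "\<dots> = (\<Sum>j<d. \<Sum>i<d. (cmod (A i j))\<^sup>2)"
    by (subst sum.swap) (simp only: isometry_norm[OF iso])
  finally show ?thesis by (simp only: sum.swap[of "\<lambda>i j. (cmod (A i j))\<^sup>2"])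
qed

text \<open>V A V^T is applied in three steps: V^T contracts as the transpose of an isometry,
  \<open>A\<close> contributes \<kappa>, and V preserves the norm.\<close>

lemma bil_isometry_contracts:
  fixes u :: "nat \<Rightarrow> nat \<Rightarrow> complex"
  assumes iso: "\<And>i j. i < d \<Longrightarrow> j < d \<Longrightarrow> (\<Sum>x<N. cnj (u x i) * u x j) = of_bool (i = j)"
    and A: "contracts d d A \<kappa>"
  shows "contracts N N (\<lambda>x y. bil d A (u x) (u y)) \<kappa>"
  unfolding contracts_def
proof
  fix v
  define s where "s j = (\<Sum>y<N. u y j * v y)" for j
  have "contracts N d u 1"
    unfolding contracts_def by (simp add: isometry_norm[OF iso])
  then have u: "(\<Sum>j<d. (cmod (s j))\<^sup>2) \<le> (\<Sum>y<N. (cmod (v y))\<^sup>2)"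
    using contracts_transpose[of N d u 1] unfolding contracts_def s_def by simp
  have "(\<Sum>y<N. bil d A (u x) (u y) * v y) = (\<Sum>i<d. u x i * (\<Sum>j<d. A i j * s j))" for x
  proof -
    have "(\<Sum>y<N. bil d A (u x) (u y) * v y) = bil d A (u x) (\<lambda>j. \<Sum>y<N. v y * u y j)"
      unfolding bil_sum_right by (simp add: mult.commute)
    then show ?thesis unfolding bil_alt2 s_def by (simp add: mult.commute)
  qed
  then have "(\<Sum>x<N. (cmod (\<Sum>y<N. bil d A (u x) (u y) * v y))\<^sup>2) = (\<Sum>i<d. (cmod (\<Sum>j<d. A i j * s j))\<^sup>2)"
    by (simp only: isometry_norm[OF iso])
  also have "\<dots> \<le> \<kappa>\<^sup>2 * (\<Sum>j<d. (cmod (s j))\<^sup>2)" using A unfolding contracts_def by blast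
  also have "\<dots> \<le> \<kappa>\<^sup>2 * (\<Sum>y<N. (cmod (v y))\<^sup>2)" by (intro mult_left_mono u) simp
  finally show "(\<Sum>x<N. (cmod (\<Sum>y<N. bil d A (u x) (u y) * v y))\<^sup>2) \<le> \<kappa>\<^sup>2 * (\<Sum>y<N. (cmod (v y))\<^sup>2)" .
qed

section \<open>Coordinates adapted to the splitting into blocks\<close>

lemma sum_blocks: "(\<Sum>x<n * k. f x) = (\<Sum>a<k. \<Sum>b<n. f (a * n + b))" for n k :: nat
proof -
  have "(\<Sum>x\<in>{a * n..<a * n + n}. f x) = (\<Sum>b<n. f (a * n + b))" for a
    by (rule sum.reindex_bij_witness[of _ "\<lambda>b. a * n + b" "\<lambda>x. x - a * n"]) auto
  then show ?thesis
    using sum.nat_group[of f n k] by (simp only: mult.commute[of n k])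
qed

lemma block_index: "a * n + b < n * k" if "a < k" "b < n" for a b n k :: nat
proof -
  have "a * n + b < Suc a * n" using that by simp
  also have "\<dots> \<le> k * n" using that by (intro mult_le_mono1) simp
  finally show ?thesis by (simp add: mult.commute)
qed

lemma sum_block_le:
  fixes f :: "nat \<Rightarrow> real"
  assumes "a < k" "\<And>x. 0 \<le> f x"
  shows "(\<Sum>b<n. f (a * n + b)) \<le> (\<Sum>x<n * k. f x)"
  unfolding sum_blocks using assms
  by (intro member_le_sum[of a "{..<k}" "\<lambda>a. \<Sum>b<n. f (a * n + b)"]) (auto intro: sum_nonneg)

lemma contracts_block:
  assumes B: "contracts (n * k) (n * k) B \<kappa>" and "a < k" "a' < k"
  shows "(\<Sum>b<n. (cmod (\<Sum>b'<n. B (a * n + b) (a' * n + b') * v b'))\<^sup>2) \<le> \<kappa>\<^sup>2 * (\<Sum>b'<n. (cmod (v b'))\<^sup>2)"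
proof -
  \<comment> \<open>The vector \<open>v\<close> placed in block \<open>a'\<close> and extended by
    zero; the rows outside block \<open>a\<close> are discarded afterwards.\<close>
  define w where "w y = (if y div n = a' then v (y mod n) else 0)" for y
  have w: "w (p * n + q) = (if p = a' then v q else 0)" if "q < n" for p q
    using that unfolding w_def by simp
  have 1: "(\<Sum>y<n * k. B x y * w y) = (\<Sum>b'<n. B x (a' * n + b') * v b')" for x
  proof -
    have "(\<Sum>y<n * k. B x y * w y) = (\<Sum>p<k. if p = a' then (\<Sum>q<n. B x (a' * n + q) * v q) else 0)"
      unfolding sum_blocks by (intro sum.cong refl) (auto simp: w)
    then show ?thesis using assms by simp
  qed
  have 2: "(\<Sum>y<n * k. (cmod (w y))\<^sup>2) = (\<Sum>b'<n. (cmod (v b'))\<^sup>2)"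
  proof -
    have "(\<Sum>y<n * k. (cmod (w y))\<^sup>2) = (\<Sum>p<k. if p = a' then (\<Sum>q<n. (cmod (v q))\<^sup>2) else 0)"
      unfolding sum_blocks by (intro sum.cong refl) (auto simp: w)
    then show ?thesis using assms by simp
  qed
  have "(\<Sum>b<n. (cmod (\<Sum>b'<n. B (a * n + b) (a' * n + b') * v b'))\<^sup>2) \<le>
     (\<Sum>x<n * k. (cmod (\<Sum>b'<n. B x (a' * n + b') * v b'))\<^sup>2)"
    using sum_block_le[of a k "\<lambda>x. (cmod (\<Sum>b'<n. B x (a' * n + b') * v b'))\<^sup>2" n] assms by simp
  also have "\<dots> \<le> \<kappa>\<^sup>2 * (\<Sum>b'<n. (cmod (v b'))\<^sup>2)"
    using B[unfolded contracts_def, rule_format, of w] unfolding 1 2 .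
  finally show ?thesis .
qed

text \<open>The matrix on \<open>\<complex>\<^sup>k \<otimes> \<complex>\<^sup>n\<close> with entry \<open>w a b p q\<close> at row \<open>e\<^sub>a \<otimes> e\<^sub>b\<close> and column \<open>e\<^sub>p \<otimes> e\<^sub>q\<close>.\<close>
definition block_mat :: "nat \<Rightarrow> nat \<Rightarrow> (nat \<Rightarrow> nat \<Rightarrow> nat \<Rightarrow> nat \<Rightarrow> complex) \<Rightarrow> complex mat" where
  "block_mat n k w = mat (n * k) (n * k) (\<lambda>(x, y). w (x div n) (x mod n) (y div n) (y mod n))"

definition block_row :: "nat \<Rightarrow> complex mat \<Rightarrow> nat \<Rightarrow> nat \<Rightarrow> nat \<Rightarrow> complex" where
  "block_row n X a b i = X $$ (a * n + b, i)"

lemma block_mat_carrier: "block_mat n k w \<in> carrier_mat (n * k) (n * k)"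
  unfolding block_mat_def by simp

lemma block_mat_index:
  assumes "a < k" "b < n" "p < k" "q < n"
  shows "block_mat n k w $$ (a * n + b, p * n + q) = w a b p q"
  unfolding block_mat_def using assms block_index[of a k b n] block_index[of p k q n] by simp

lemma adjoint_index:
  "i < dim_col X \<Longrightarrow> j < dim_row X \<Longrightarrow> mat_adjoint X $$ (i, j) = cnj (X $$ (j, i))"
  by (simp add: mat_adjoint_def mat_of_rows_def)

lemma adjoint_dim: "dim_row (mat_adjoint X) = dim_col X" "dim_col (mat_adjoint X) = dim_row X"
  by (simp_all add: mat_adjoint_def mat_of_rows_def)

lemma mat_mult_index:
  assumes "X \<in> carrier_mat n m" "Y \<in> carrier_mat m l" "i < n" "j < l"
  shows "(X * Y) $$ (i, j) = (\<Sum>x<m. X $$ (i, x) * Y $$ (x, j))"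
  using assms by (auto simp: scalar_prod_def atLeast0LessThan)

lemma unitary_block_mat:
  assumes w: "\<And>a b a' b'. a < k \<Longrightarrow> b < n \<Longrightarrow> a' < k \<Longrightarrow> b' < n \<Longrightarrow>
     (\<Sum>p<k. \<Sum>q<n. cnj (w p q a b) * w p q a' b') = of_bool (a = a' \<and> b = b')"
  shows "unitary_mat (n * k) (block_mat n k w)"
  unfolding unitary_mat_def
proof
  show W: "block_mat n k w \<in> carrier_mat (n * k) (n * k)" by (rule block_mat_carrier)
  then have W': "mat_adjoint (block_mat n k w) \<in> carrier_mat (n * k) (n * k)"
    by (intro carrier_matI) (simp_all add: adjoint_dim)
  show "mat_adjoint (block_mat n k w) * block_mat n k w = 1\<^sub>m (n * k)"
  proof (rule eq_matI)
    fix x y assume "x < dim_row (1\<^sub>m (n * k) :: complex mat)" "y < dim_col (1\<^sub>m (n * k) :: complex mat)"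
    then have xy: "x < n * k" "y < n * k" by auto
    then have n: "0 < n" by (cases n) auto
    have lt: "x div n < k" "x mod n < n" "y div n < k" "y mod n < n"
      using xy n by (auto simp: less_mult_imp_div_less mult.commute)
    have "(mat_adjoint (block_mat n k w) * block_mat n k w) $$ (x, y) =
       (\<Sum>z<n * k. cnj (block_mat n k w $$ (z, x)) * block_mat n k w $$ (z, y))"
      unfolding mat_mult_index[OF W' W xy]
      by (intro sum.cong refl) (use W xy in \<open>simp add: adjoint_index\<close>)
    also have "\<dots> = (\<Sum>p<k. \<Sum>q<n. cnj (block_mat n k w $$ (p * n + q, x div n * n + x mod n)) *
         block_mat n k w $$ (p * n + q, y div n * n + y mod n))"
      unfolding sum_blocks by simp
    also have "\<dots> = (\<Sum>p<k. \<Sum>q<n. cnj (w p q (x div n) (x mod n)) * w p q (y div n) (y mod n))"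
      using lt by (intro sum.cong refl) (simp only: block_mat_index lessThan_iff)
    also have "\<dots> = of_bool (x div n = y div n \<and> x mod n = y mod n)"
      using w lt by blast
    also have "(x div n = y div n \<and> x mod n = y mod n) \<longleftrightarrow> x = y"
      by (metis div_mult_mod_eq)
    finally show "(mat_adjoint (block_mat n k w) * block_mat n k w) $$ (x, y) = 1\<^sub>m (n * k) $$ (x, y)"
      using xy by simp
  qed (use W in \<open>auto simp: adjoint_dim\<close>)
qed

lemma block_row_mult:
  assumes "X \<in> carrier_mat (n * k) (n * k)" "a < k" "b < n" "i < n * k"
  shows "block_row n (block_mat n k w * X) a b i = (\<Sum>p<k. \<Sum>q<n. w a b p q * block_row n X p q i)"
  unfolding block_row_def
    mat_mult_index[OF block_mat_carrier assms(1) block_index[OF assms(2,3)] assms(4)] sum_blocks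
  using assms(2,3) by (intro sum.cong refl) (simp only: block_mat_index lessThan_iff)

lemma overlap_cong:
  assumes "\<And>a b i. a < k \<Longrightarrow> b < n \<Longrightarrow> i < d \<Longrightarrow> r a b i = r' a b i"
    and "a < k" "a' < k" "c < k" "c' < k"
  shows "overlap n d A r a a' c c' = overlap n d A r' a a' c c'"
  using assms unfolding overlap_def bil_def by simp

lemma twist_unitary:
  assumes "c < k"
    and v: "\<And>x y. x < n \<Longrightarrow> y < n \<Longrightarrow> (\<Sum>z<n. cnj (v z x) * v z y) = of_bool (x = y)"
  obtains W where "unitary_mat (n * k) W"
    "\<And>X a b i. X \<in> carrier_mat (n * k) (n * k) \<Longrightarrow> a < k \<Longrightarrow> b < n \<Longrightarrow> i < n * k \<Longrightarrow>
      block_row n (W * X) a b i = twist n c v (block_row n X) a b i"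
proof
  \<comment> \<open>Block diagonal, with \<open>v\<close> in block \<open>c\<close> and the identity
    in all others.\<close>
  define w where "w a b p q = (if p = a then if a = c then v b q else of_bool (q = b) else 0)" for a b p q
  show "unitary_mat (n * k) (block_mat n k w)"
  proof (rule unitary_block_mat)
    fix a b a' b' assume l: "a < k" "b < n" "a' < k" "b' < n"
    have "(\<Sum>p<k. \<Sum>q<n. cnj (w p q a b) * w p q a' b') =
      (\<Sum>p<k. if p = a then (\<Sum>q<n. cnj (w a q a b) * w a q a' b') else 0)"
      by (intro sum.cong refl) (auto simp: w_def)
    also have "\<dots> = (\<Sum>q<n. cnj (w a q a b) * w a q a' b')" using l by simp
    also have "\<dots> = of_bool (a = a' \<and> b = b')"
    proof (cases "a' = a")
      case True
      show ?thesis
      proof (cases "a = c")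
        case True
        then show ?thesis using v[OF l(2,4)] \<open>a' = a\<close> by (simp add: w_def)
      next
        case False
        have "(\<Sum>q<n. cnj (w a q a b) * w a q a' b') = (\<Sum>q<n. if q = b then of_bool (b' = b) else 0)"
          using False \<open>a' = a\<close> by (intro sum.cong refl) (auto simp: w_def)
        then show ?thesis using l \<open>a' = a\<close> by auto
      qed
    next
      case False
      then show ?thesis by (auto simp: w_def)
    qed
    finally show "(\<Sum>p<k. \<Sum>q<n. cnj (w p q a b) * w p q a' b') = of_bool (a = a' \<and> b = b')" .
  qed
  fix X :: "complex mat" and a b i assume X: "X \<in> carrier_mat (n * k) (n * k)" and l: "a < k" "b < n" "i < n * k"
  have "block_row n (block_mat n k w * X) a b i = (\<Sum>p<k. if p = a then (\<Sum>q<n. w a b a q * block_row n X a q i) else 0)"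
    unfolding block_row_mult[OF X l] by (intro sum.cong refl) (auto simp: w_def)
  also have "\<dots> = (\<Sum>q<n. w a b a q * block_row n X a q i)" using l by simp
  also have "\<dots> = twist n c v (block_row n X) a b i"
  proof (cases "a = c")
    case True
    then show ?thesis unfolding twist_def w_def by simp
  next
    case False
    have "(\<Sum>q<n. w a b a q * block_row n X a q i) = (\<Sum>q<n. if q = b then block_row n X a q i else 0)"
      using False by (intro sum.cong refl) (auto simp: w_def)
    then show ?thesis using False l unfolding twist_def by simp
  qed
  finally show "block_row n (block_mat n k w * X) a b i = twist n c v (block_row n X) a b i" .
qed

lemma rotate_unitary:
  obtains W where "unitary_mat (n * k) W"
    "\<And>X a b i. X \<in> carrier_mat (n * k) (n * k) \<Longrightarrow> a < k \<Longrightarrow> b < n \<Longrightarrow> i < n * k \<Longrightarrow>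
      block_row n (W * X) a b i = (\<Sum>p<k. dft k a p * block_row n X p b i)"
proof
  \<comment> \<open>The Fourier matrix on the first tensor factor, the identity on the
    second.\<close>
  define w where "w a b p q = (if q = b then dft k a p else 0)" for a b p q :: nat
  show "unitary_mat (n * k) (block_mat n k w)"
  proof (rule unitary_block_mat)
    fix a b a' b' assume l: "a < k" "b < n" "a' < k" "b' < n"
    have "(\<Sum>q<n. cnj (w p q a b) * w p q a' b') = of_bool (b = b') * (cnj (dft k p a) * dft k p a')" for p
    proof -
      have "(\<Sum>q<n. cnj (w p q a b) * w p q a' b') =
        (\<Sum>q<n. if q = b then of_bool (b = b') * (cnj (dft k p a) * dft k p a') else 0)"
        by (intro sum.cong refl) (auto simp: w_def)
      then show ?thesis using l by simp
    qed
    then have "(\<Sum>p<k. \<Sum>q<n. cnj (w p q a b) * w p q a' b') = of_bool (b = b') * (\<Sum>p<k. cnj (dft k p a) * dft k p a')"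
      by (simp only: sum_distrib_left)
    then show "(\<Sum>p<k. \<Sum>q<n. cnj (w p q a b) * w p q a' b') = of_bool (a = a' \<and> b = b')"
      using dft_unitary[of a k a'] l by auto
  qed
  fix X :: "complex mat" and a b i assume X: "X \<in> carrier_mat (n * k) (n * k)" and l: "a < k" "b < n" "i < n * k"
  have "(\<Sum>q<n. w a b p q * block_row n X p q i) = (\<Sum>q<n. if q = b then dft k a p * block_row n X p b i else 0)" for p
    by (intro sum.cong refl) (auto simp: w_def)
  then show "block_row n (block_mat n k w * X) a b i = (\<Sum>p<k. dft k a p * block_row n X p b i)"
    unfolding block_row_mult[OF X l] using l by simp
qed

section \<open>The random channel output\<close>

text \<open>V times a matrix unit times V* is column \<open>i\<close> of V times the adjoint of
  column \<open>i'\<close>; the partial trace sums the product over the second tensor index.\<close>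

lemma chanC_index:
  assumes U: "U \<in> carrier_mat (n * k) (n * k)" and d: "d \<le> n * k"
    and i: "i < d" "i' < d" and a: "a < k" "c < k"
  shows "chanC k n d U (munit d i i') $$ (a, c) = (\<Sum>b<n. block_row n U a b i * cnj (block_row n U c b i'))"
proof -
  define V where "V = isom_cols d U"
  have V: "V \<in> carrier_mat (n * k) d" using U unfolding V_def isom_cols_def by simp
  have VA: "mat_adjoint V \<in> carrier_mat d (n * k)"
    using V by (intro carrier_matI) (simp_all add: adjoint_dim)
  have E: "munit d i i' \<in> carrier_mat d d" unfolding munit_def by simp
  have Vi: "V $$ (x, j) = U $$ (x, j)" if "x < n * k" "j < d" for x j
    using that U unfolding V_def isom_cols_def by simp
  have VE: "(V * munit d i i') $$ (x, j) = (if j = i' then U $$ (x, i) else 0)" if "x < n * k" "j < d" for x j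
  proof -
    have "(V * munit d i i') $$ (x, j) = (\<Sum>l<d. if l = i then (if j = i' then U $$ (x, i) else 0) else 0)"
      unfolding mat_mult_index[OF V E that]
      by (intro sum.cong refl) (use that i in \<open>auto simp: munit_def Vi\<close>)
    then show ?thesis using i by simp
  qed
  have VEV: "(V * munit d i i' * mat_adjoint V) $$ (x, y) = U $$ (x, i) * cnj (U $$ (y, i'))"
    if "x < n * k" "y < n * k" for x y
  proof -
    have "(V * munit d i i' * mat_adjoint V) $$ (x, y) =
        (\<Sum>j<d. if j = i' then U $$ (x, i) * cnj (U $$ (y, i')) else 0)"
      unfolding mat_mult_index[OF mult_carrier_mat[OF V E] VA that]
      by (intro sum.cong refl) (use that V in \<open>auto simp: VE adjoint_index Vi\<close>)
    then show ?thesis using i by simp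
  qed
  have "chanC k n d U (munit d i i') $$ (a, c) = (\<Sum>b<n. (V * munit d i i' * mat_adjoint V) $$ (a * n + b, c * n + b))"
    unfolding chanC_def ptrace2_def V_def using a by simp
  also have "\<dots> = (\<Sum>b<n. block_row n U a b i * cnj (block_row n U c b i'))"
    using a by (intro sum.cong refl) (simp add: VEV block_index block_row_def)
  finally show ?thesis .
qed

text \<open>The coefficients of the pure state factor into an entry of \<open>A\<close> and a
  conjugated entry. With the two partial traces moved outside, the sum over \<open>(i, j)\<close> is
  therefore an entry of V A V^T and the sum over \<open>(i', j')\<close> the conjugate of
  one.\<close>

lemma tensor_chanC_index:
  assumes U: "U \<in> carrier_mat (n * k) (n * k)" and d: "d \<le> n * k"
    and l: "a < k" "a' < k" "c < k" "c' < k"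
  shows "tensor_map d k (chanC k n d U) (chanC k n d U) (ketbra (psi_vec d A)) $$ (a * k + a', c * k + c') =
    overlap n d (\<lambda>i j. A $$ (i, j)) (block_row n U) a a' c c'"
proof -
  let ?I = "{..<d} \<times> {..<d}"
  let ?N = "{..<n} \<times> {..<n}"
  define f where "f p q b s = A $$ s * (block_row n U p (fst b) (fst s) * block_row n U q (snd b) (snd s))" for p q b s
  have kk: "a * k + a' < k * k" "c * k + c' < k * k" using l block_index by auto
  have dim: "dim_row (chanC k n d U Y) = k" "dim_col (chanC k n d U Y) = k" for Y
    unfolding chanC_def ptrace2_def by simp_all
  have kb: "ketbra (psi_vec d A) $$ (i * d + j, i' * d + j') = A $$ (i, j) * cnj (A $$ (i', j'))"
    if "i < d" "j < d" "i' < d" "j' < d" for i j i' j'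
    using block_index[of i d j d] block_index[of i' d j' d] that unfolding ketbra_def psi_vec_def by simp
  have kr: "kron (chanC k n d U Y) (chanC k n d U Y') $$ (a * k + a', c * k + c') =
      chanC k n d U Y $$ (a, c) * chanC k n d U Y' $$ (a', c')" for Y Y'
    using kk l unfolding kron_def dim by (simp add: dim)
  have "tensor_map d k (chanC k n d U) (chanC k n d U) (ketbra (psi_vec d A)) $$ (a * k + a', c * k + c') =
     (\<Sum>i<d. \<Sum>j<d. \<Sum>i'<d. \<Sum>j'<d. A $$ (i, j) * cnj (A $$ (i', j')) *
       ((\<Sum>b<n. block_row n U a b i * cnj (block_row n U c b i')) * (\<Sum>b'<n. block_row n U a' b' j * cnj (block_row n U c' b' j'))))"
    using kk unfolding tensor_map_def
    by (simp, intro sum.cong refl) (simp add: kb kr chanC_index[OF U d _ _ l(1,3)] chanC_index[OF U d _ _ l(2,4)])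
  also have "\<dots> = (\<Sum>i<d. \<Sum>j<d. \<Sum>i'<d. \<Sum>j'<d. \<Sum>b\<in>?N. f a a' b (i, j) * cnj (f c c' b (i', j')))"
    unfolding sum_product
    unfolding sum.cartesian_product' f_def fst_conv snd_conv sum_distrib_left
    by (simp add: mult_ac)
  also have "\<dots> = (\<Sum>s\<in>?I. \<Sum>s'\<in>?I. \<Sum>b\<in>?N. f a a' b s * cnj (f c c' b s'))"
    by (simp only: sum.cartesian_product'[of _ "{..<d}" "{..<d}"])
  also have "\<dots> = (\<Sum>b\<in>?N. (\<Sum>s\<in>?I. f a a' b s) * cnj (\<Sum>s\<in>?I. f c c' b s))"
    unfolding cnj_sum sum_product by (rule sum_swap3[symmetric])
  also have "\<dots> = overlap n d (\<lambda>i j. A $$ (i, j)) (block_row n U) a a' c c'"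
    unfolding overlap_def bil_def f_def sum.cartesian_product' fst_conv snd_conv mult.assoc ..
  finally show ?thesis .
qed

text \<open>Haar invariance is an equality of laws on the space of entry functions, so overlaps have
  to be written as functions on that space.\<close>

definition entry_rows :: "nat \<Rightarrow> (nat \<times> nat \<Rightarrow> complex) \<Rightarrow> nat \<Rightarrow> nat \<Rightarrow> nat \<Rightarrow> complex" where
  "entry_rows n u a b i = u (a * n + b, i)"

lemma overlap_entry_rows:
  assumes "d \<le> n * k" "a < k" "a' < k" "c < k" "c' < k"
  shows "overlap n d A (entry_rows n (mat_entries (n * k) X)) a a' c c' = overlap n d A (block_row n X) a a' c c'"
  using assms
  by (intro overlap_cong[of k]) (auto simp: entry_rows_def block_row_def mat_entries_def block_index)

lemma cnj_measurable: "cnj \<in> borel_measurable borel"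
  by (intro borel_measurable_continuous_onI continuous_intros)

lemma overlap_measurable:
  assumes "d \<le> n * k" "a < k" "a' < k" "c < k" "c' < k"
  shows "(\<lambda>u. overlap n d A (entry_rows n u) a a' c c') \<in> borel_measurable (mat_space (n * k))"
proof -
  have "(\<lambda>u. entry_rows n u p b i) \<in> borel_measurable (mat_space (n * k))" if "p < k" "b < n" "i < d" for p b i
    unfolding entry_rows_def using that assms(1) block_index[of p k b n]
    by (intro measurable_component_singleton) auto
  then have "(\<lambda>u. bil d A (entry_rows n u p b) (entry_rows n u q b')) \<in> borel_measurable (mat_space (n * k))"
    if "p < k" "b < n" "q < k" "b' < n" for p b q b'
    unfolding bil_def using that
    by (intro borel_measurable_sum borel_measurable_times borel_measurable_const) auto
  then show ?thesis
    unfolding overlap_def using assms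
    by (intro borel_measurable_sum borel_measurable_times measurable_compose[OF _ cnj_measurable]) auto
qed

lemma measurable_unitary_mult:
  assumes X: "\<And>\<omega>. \<omega> \<in> space M \<Longrightarrow> X \<omega> \<in> carrier_mat N N" and W: "W \<in> carrier_mat N N"
    and m: "(\<lambda>\<omega>. mat_entries N (X \<omega>)) \<in> M \<rightarrow>\<^sub>M mat_space N"
  shows "(\<lambda>\<omega>. mat_entries N (W * X \<omega>)) \<in> M \<rightarrow>\<^sub>M mat_space N"
  unfolding mat_entries_def
proof (rule measurable_restrict)
  fix ij assume ij: "ij \<in> {..<N} \<times> {..<N}"
  have e: "(\<lambda>\<omega>. mat_entries N (X \<omega>) (l, snd ij)) \<in> borel_measurable M" if "l < N" for l
    using measurable_compose[OF m measurable_component_singleton[of "(l, snd ij)"]] that ij by auto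
  have "(\<lambda>\<omega>. \<Sum>l<N. W $$ (fst ij, l) * mat_entries N (X \<omega>) (l, snd ij)) \<in> borel_measurable M"
    using e by (intro borel_measurable_sum borel_measurable_times borel_measurable_const) auto
  moreover have "(W * X \<omega>) $$ ij = (\<Sum>l<N. W $$ (fst ij, l) * mat_entries N (X \<omega>) (l, snd ij))"
    if "\<omega> \<in> space M" for \<omega>
    using mat_mult_index[OF W X[OF that], of "fst ij" "snd ij"] ij by (auto simp: mat_entries_def)
  ultimately show "(\<lambda>\<omega>. (W * X \<omega>) $$ ij) \<in> borel_measurable M"
    by (simp cong: measurable_cong)
qed

section \<open>Second moments of the overlaps for one fixed n\<close>

locale haar_blocks = prob_space M for M :: "'w measure" +
  fixes n k d :: nat and A :: "nat \<Rightarrow> nat \<Rightarrow> complex" and X :: "'w \<Rightarrow> complex mat" and \<kappa> :: real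
  assumes haar: "haar_distributed M (n * k) X"
    and n: "0 < n" and k: "0 < k" and d: "d \<le> n * k"
    and A_norm: "(\<Sum>i<d. \<Sum>j<d. (cmod (A i j))\<^sup>2) = 1"
    and A_contracts: "contracts d d A \<kappa>"
begin

abbreviation ov :: "'w \<Rightarrow> nat \<Rightarrow> nat \<Rightarrow> nat \<Rightarrow> nat \<Rightarrow> complex" where
  "ov \<omega> \<equiv> overlap n d A (block_row n (X \<omega>))"

lemma X_unitary: "\<omega> \<in> space M \<Longrightarrow> unitary_mat (n * k) (X \<omega>)"
  using haar unfolding haar_distributed_def by blast

lemma X_carrier: "\<omega> \<in> space M \<Longrightarrow> X \<omega> \<in> carrier_mat (n * k) (n * k)"
  using X_unitary unfolding unitary_mat_def by blast

lemma X_measurable: "(\<lambda>\<omega>. mat_entries (n * k) (X \<omega>)) \<in> M \<rightarrow>\<^sub>M mat_space (n * k)"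
  using haar unfolding haar_distributed_def by blast

lemma X_isometry:
  assumes "\<omega> \<in> space M" "i < d" "j < d"
  shows "(\<Sum>x<n * k. cnj (X \<omega> $$ (x, i)) * X \<omega> $$ (x, j)) = of_bool (i = j)"
proof -
  let ?U = "X \<omega>"
  have U: "?U \<in> carrier_mat (n * k) (n * k)" using assms X_carrier by blast
  then have U': "mat_adjoint ?U \<in> carrier_mat (n * k) (n * k)"
    by (intro carrier_matI) (simp_all add: adjoint_dim)
  have ij: "i < n * k" "j < n * k" using assms d by auto
  have "(\<Sum>x<n * k. cnj (?U $$ (x, i)) * ?U $$ (x, j)) = (mat_adjoint ?U * ?U) $$ (i, j)"
    unfolding mat_mult_index[OF U' U ij]
    by (intro sum.cong refl) (use U ij in \<open>simp add: adjoint_index\<close>)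
  then show ?thesis using X_unitary[OF assms(1)] ij unfolding unitary_mat_def by simp
qed

lemma block_norm:
  assumes "\<omega> \<in> space M"
  shows "(\<Sum>a<k. \<Sum>b<n. \<Sum>a'<k. \<Sum>b'<n. (cmod (bil d A (block_row n (X \<omega>) a b) (block_row n (X \<omega>) a' b')))\<^sup>2) = 1"
  using bil_isometry_norm[where N = "n * k" and u = "\<lambda>x i. X \<omega> $$ (x, i)" and A = A, OF X_isometry[OF assms]] A_norm
  by (simp add: sum_blocks block_row_def[abs_def])

lemma block_norm_le:
  assumes "\<omega> \<in> space M" "a < k" "a' < k"
  shows "(\<Sum>b<n. \<Sum>b'<n. (cmod (bil d A (block_row n (X \<omega>) a b) (block_row n (X \<omega>) a' b')))\<^sup>2) \<le> 1"
proof -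
  let ?f = "\<lambda>a b a' b'. (cmod (bil d A (block_row n (X \<omega>) a b) (block_row n (X \<omega>) a' b')))\<^sup>2"
  have "(\<Sum>b<n. \<Sum>b'<n. ?f a b a' b') \<le> (\<Sum>b<n. \<Sum>a'<k. \<Sum>b'<n. ?f a b a' b')"
    using assms by (intro sum_mono member_le_sum[of a' "{..<k}" "\<lambda>a'. \<Sum>b'<n. ?f a _ a' b'"]) (auto intro: sum_nonneg)
  also have "\<dots> \<le> (\<Sum>a<k. \<Sum>b<n. \<Sum>a'<k. \<Sum>b'<n. ?f a b a' b')"
    using assms by (intro member_le_sum[of a "{..<k}" "\<lambda>a. \<Sum>b<n. \<Sum>a'<k. \<Sum>b'<n. ?f a b a' b'"]) (auto intro!: sum_nonneg)
  finally show ?thesis using block_norm[OF assms(1)] by simp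
qed

lemma block_contracts:
  assumes "\<omega> \<in> space M" "a < k" "a' < k"
  shows "(\<Sum>b<n. (cmod (\<Sum>b'<n. bil d A (block_row n (X \<omega>) a b) (block_row n (X \<omega>) a' b') * v b'))\<^sup>2)
    \<le> \<kappa>\<^sup>2 * (\<Sum>b'<n. (cmod (v b'))\<^sup>2)"
  using contracts_block[OF bil_isometry_contracts[where N = "n * k" and u = "\<lambda>x i. X \<omega> $$ (x, i)", OF X_isometry[OF assms(1)] A_contracts]
    assms(2,3), of v]
  by (simp add: block_row_def[abs_def])

text \<open>The diagonal overlaps are the squared Hilbert-Schmidt norms of the blocks, which add up
  to that of V A V^T and hence to that of \<open>A\<close>.\<close>

lemma trace_one:
  assumes "\<omega> \<in> space M"
  shows "(\<Sum>s\<in>{..<k} \<times> {..<k}. ov \<omega> (fst s) (snd s) (fst s) (snd s)) = 1"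
proof -
  let ?f = "\<lambda>a b a' b'. (cmod (bil d A (block_row n (X \<omega>) a b) (block_row n (X \<omega>) a' b')))\<^sup>2"
  have "(\<Sum>s\<in>{..<k} \<times> {..<k}. ov \<omega> (fst s) (snd s) (fst s) (snd s)) =
     (\<Sum>a<k. \<Sum>a'<k. \<Sum>b<n. \<Sum>b'<n. complex_of_real (?f a b a' b'))"
    unfolding sum.cartesian_product' fst_conv snd_conv overlap_def complex_norm_square ..
  also have "\<dots> = (\<Sum>a<k. \<Sum>b<n. \<Sum>a'<k. \<Sum>b'<n. complex_of_real (?f a b a' b'))"
    by (intro sum.cong refl sum.swap)
  also have "\<dots> = complex_of_real (\<Sum>a<k. \<Sum>b<n. \<Sum>a'<k. \<Sum>b'<n. ?f a b a' b')"
    by (simp only: of_real_sum)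
  finally show ?thesis unfolding block_norm[OF assms] by simp
qed

text \<open>Cauchy-Schwarz for two blocks of Hilbert-Schmidt norm at most 1. This deterministic
  bound supplies integrability and later the domination for the moments.\<close>

lemma norm_ov_le:
  assumes "\<omega> \<in> space M" "a < k" "a' < k" "c < k" "c' < k"
  shows "cmod (ov \<omega> a a' c c') \<le> 1"
proof -
  let ?B = "\<lambda>a a' b. bil d A (block_row n (X \<omega>) a (fst b)) (block_row n (X \<omega>) a' (snd b))"
  let ?N = "{..<n} \<times> {..<n}"
  have "(cmod (ov \<omega> a a' c c'))\<^sup>2 = (cmod (\<Sum>b\<in>?N. ?B a a' b * cnj (?B c c' b)))\<^sup>2"
    unfolding overlap_def sum.cartesian_product' fst_conv snd_conv ..
  also have "\<dots> \<le> (\<Sum>b\<in>?N. (cmod (?B a a' b))\<^sup>2) * (\<Sum>b\<in>?N. (cmod (cnj (?B c c' b)))\<^sup>2)"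
    by (rule cmod_sum_mult_le)
  also have "\<dots> \<le> 1 * 1"
    unfolding sum.cartesian_product' fst_conv snd_conv complex_mod_cnj
    using assms by (intro mult_mono block_norm_le sum_nonneg) auto
  finally show ?thesis by (simp add: abs_square_le_1)
qed

lemma ov_measurable:
  assumes "a < k" "a' < k" "c < k" "c' < k"
  shows "(\<lambda>\<omega>. ov \<omega> a a' c c') \<in> borel_measurable M"
  using measurable_compose[OF X_measurable overlap_measurable[OF d assms, of A]]
  by (simp only: overlap_entry_rows[OF d assms])

lemma haar_invariance:
  fixes h :: "complex \<Rightarrow> real"
  assumes W: "unitary_mat (n * k) W" and l: "a < k" "a' < k" "c < k" "c' < k"
    and h: "h \<in> borel_measurable borel"
  shows "(\<integral>\<omega>. h (overlap n d A (block_row n (W * X \<omega>)) a a' c c') \<partial>M) = (\<integral>\<omega>. h (ov \<omega> a a' c c') \<partial>M)"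
proof -
  let ?g = "\<lambda>u. h (overlap n d A (entry_rows n u) a a' c c')"
  have g: "?g \<in> borel_measurable (mat_space (n * k))"
    by (rule measurable_compose[OF overlap_measurable[OF d l] h])
  have mW: "(\<lambda>\<omega>. mat_entries (n * k) (W * X \<omega>)) \<in> M \<rightarrow>\<^sub>M mat_space (n * k)"
    using W X_carrier X_measurable unfolding unitary_mat_def by (intro measurable_unitary_mult) auto
  have "(\<integral>\<omega>. ?g (mat_entries (n * k) (W * X \<omega>)) \<partial>M) =
      (\<integral>u. ?g u \<partial>distr M (mat_space (n * k)) (\<lambda>\<omega>. mat_entries (n * k) (W * X \<omega>)))"
    by (rule integral_distr[OF mW g, symmetric])
  also have "\<dots> = (\<integral>u. ?g u \<partial>distr M (mat_space (n * k)) (\<lambda>\<omega>. mat_entries (n * k) (X \<omega>)))"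
    using haar W unfolding haar_distributed_def by simp
  also have "\<dots> = (\<integral>\<omega>. ?g (mat_entries (n * k) (X \<omega>)) \<partial>M)"
    by (rule integral_distr[OF X_measurable g])
  finally show ?thesis by (simp only: overlap_entry_rows[OF d l])
qed

text \<open>Equality of Bochner integrals says nothing about integrability, which monotonicity and
  the exchange with finite sums require.\<close>

lemma haar_invariance_integrable:
  fixes h :: "complex \<Rightarrow> real"
  assumes W: "unitary_mat (n * k) W" and l: "a < k" "a' < k" "c < k" "c' < k"
    and h: "h \<in> borel_measurable borel"
    and int: "integrable M (\<lambda>\<omega>. h (ov \<omega> a a' c c'))"
  shows "integrable M (\<lambda>\<omega>. h (overlap n d A (block_row n (W * X \<omega>)) a a' c c'))"
proof -
  let ?g = "\<lambda>u. h (overlap n d A (entry_rows n u) a a' c c')"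
  have g: "?g \<in> borel_measurable (mat_space (n * k))"
    by (rule measurable_compose[OF overlap_measurable[OF d l] h])
  have mW: "(\<lambda>\<omega>. mat_entries (n * k) (W * X \<omega>)) \<in> M \<rightarrow>\<^sub>M mat_space (n * k)"
    using W X_carrier X_measurable unfolding unitary_mat_def by (intro measurable_unitary_mult) auto
  have "integrable M (\<lambda>\<omega>. ?g (mat_entries (n * k) (X \<omega>)))"
    using int by (simp only: overlap_entry_rows[OF d l])
  then have "integrable (distr M (mat_space (n * k)) (\<lambda>\<omega>. mat_entries (n * k) (X \<omega>))) ?g"
    by (simp only: integrable_distr_eq[OF X_measurable g])
  also have "distr M (mat_space (n * k)) (\<lambda>\<omega>. mat_entries (n * k) (X \<omega>)) =
      distr M (mat_space (n * k)) (\<lambda>\<omega>. mat_entries (n * k) (W * X \<omega>))"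
    using haar W unfolding haar_distributed_def by simp
  finally have "integrable M (\<lambda>\<omega>. ?g (mat_entries (n * k) (W * X \<omega>)))"
    by (simp only: integrable_distr_eq[OF mW g])
  then show ?thesis by (simp only: overlap_entry_rows[OF d l])
qed

lemma ov_square_integrable:
  assumes "a < k" "a' < k" "c < k" "c' < k" "cmod e \<le> 1"
  shows "integrable M (\<lambda>\<omega>. (cmod (ov \<omega> a a' c c' - e))\<^sup>2)"
proof (rule integrable_const_bound[where B = 4])
  show "(\<lambda>\<omega>. (cmod (ov \<omega> a a' c c' - e))\<^sup>2) \<in> borel_measurable M"
    using ov_measurable[OF assms(1-4)] by measurable
  have "(cmod (ov \<omega> a a' c c' - e))\<^sup>2 \<le> 4" if "\<omega> \<in> space M" for \<omega>
  proof -
    have "cmod (ov \<omega> a a' c c' - e) \<le> 2"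
      using norm_triangle_ineq4[of "ov \<omega> a a' c c'" e] norm_ov_le[OF that assms(1-4)] assms(5) by linarith
    then have "(cmod (ov \<omega> a a' c c' - e))\<^sup>2 \<le> 2\<^sup>2" by (intro power_mono) auto
    then show ?thesis by simp
  qed
  then show "AE \<omega> in M. norm ((cmod (ov \<omega> a a' c c' - e))\<^sup>2) \<le> 4" by simp
qed

text \<open>Each of the 3^n * 3^n scramblers leaves the expectation unchanged, so it equals the
  expectation of the average, and that average is bounded for every single outcome.\<close>

lemma ov_twist_bound:
  assumes l: "a < k" "a' < k" "c < k" "c' < k" and ac: "a \<noteq> c" "\<not> (a' = c \<and> c' = c)"
  shows "(\<integral>\<omega>. (cmod (ov \<omega> a a' c c'))\<^sup>2 \<partial>M) \<le> 4 / (real n)\<^sup>2 + \<kappa>\<^sup>2 / real n"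
proof -
  let ?I = "\<integral>\<omega>. (cmod (ov \<omega> a a' c c'))\<^sup>2 \<partial>M"
  let ?t = "\<lambda>j l \<omega>. (cmod (overlap n d A (twist n c (scrambler n j l) (block_row n (X \<omega>))) a a' c c'))\<^sup>2"
  have tw: "(\<integral>\<omega>. ?t j l \<omega> \<partial>M) = ?I \<and> integrable M (?t j l)" for j l
  proof -
    obtain W where W: "unitary_mat (n * k) W"
      and rows: "\<And>X a b i. X \<in> carrier_mat (n * k) (n * k) \<Longrightarrow> a < k \<Longrightarrow> b < n \<Longrightarrow> i < n * k \<Longrightarrow>
        block_row n (W * X) a b i = twist n c (scrambler n j l) (block_row n X) a b i"
      using twist_unitary[OF \<open>c < k\<close> scrambler_unitary] by metis
    have eq: "overlap n d A (block_row n (W * X \<omega>)) a a' c c' =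
       overlap n d A (twist n c (scrambler n j l) (block_row n (X \<omega>))) a a' c c'" if "\<omega> \<in> space M" for \<omega>
      using d by (intro overlap_cong[of k] l rows X_carrier that) auto
    have "(\<integral>\<omega>. ?t j l \<omega> \<partial>M) = (\<integral>\<omega>. (cmod (overlap n d A (block_row n (W * X \<omega>)) a a' c c'))\<^sup>2 \<partial>M)"
      by (intro Bochner_Integration.integral_cong refl) (simp add: eq)
    also have "\<dots> = ?I"
      by (rule haar_invariance[OF W assms(1-4), of "\<lambda>z. (cmod z)\<^sup>2"]) measurable
    finally have 1: "(\<integral>\<omega>. ?t j l \<omega> \<partial>M) = ?I" .
    have "integrable M (\<lambda>\<omega>. (cmod (overlap n d A (block_row n (W * X \<omega>)) a a' c c'))\<^sup>2)"
      using haar_invariance_integrable[OF W assms(1-4), of "\<lambda>z. (cmod z)\<^sup>2"] ov_square_integrable[OF assms(1-4), of 0]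
      by simp
    then have "integrable M (?t j l)"
      using eq by (simp cong: Bochner_Integration.integrable_cong)
    with 1 show ?thesis by simp
  qed
  have "3 ^ n * 3 ^ n * ?I = (\<Sum>j<3 ^ n. \<Sum>l<3 ^ n. \<integral>\<omega>. ?t j l \<omega> \<partial>M)"
    using tw by simp
  also have "\<dots> = (\<integral>\<omega>. (\<Sum>j<3 ^ n. \<Sum>l<3 ^ n. ?t j l \<omega>) \<partial>M)"
    using tw by simp
  also have "\<dots> \<le> (\<integral>\<omega>. 3 ^ n * 3 ^ n * (4 / (real n)\<^sup>2 + \<kappa>\<^sup>2 / real n) \<partial>M)"
  proof (rule integral_mono)
    fix \<omega> assume "\<omega> \<in> space M"
    then show "(\<Sum>j<3 ^ n. \<Sum>l<3 ^ n. ?t j l \<omega>) \<le> 3 ^ n * 3 ^ n * (4 / (real n)\<^sup>2 + \<kappa>\<^sup>2 / real n)"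
      by (intro sum_overlap_twist[OF n ac l] block_norm_le block_contracts)
  qed (use tw in auto)
  finally have "3 ^ n * 3 ^ n * ?I \<le> 3 ^ n * 3 ^ n * (4 / (real n)\<^sup>2 + \<kappa>\<^sup>2 / real n)"
    by (simp add: prob_space)
  then show ?thesis by (subst (asm) mult_le_cancel_left_pos) auto
qed

text \<open>\<open>A\<close> is a parameter of the locale so that every bound can be reused for the
  transposed input, where the two tensor factors have changed places.\<close>

lemma transpose: "haar_blocks M n k d (\<lambda>i j. A j i) X \<kappa>"
proof unfold_locales
  show "(\<Sum>i<d. \<Sum>j<d. (cmod (A j i))\<^sup>2) = 1" using A_norm by (subst sum.swap)
qed (use haar n k d contracts_transpose[OF A_contracts] in auto)

text \<open>If the first indices differ, twisting the third slot works unless its index fills the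
  last three slots; exchanging the two blocks then puts the index of the first slot, which occurs
  only once, in the third. If the first indices agree, the second ones differ and transposing
  \<open>A\<close> brings them to the front.\<close>

lemma ov_offdiag_bound:
  assumes l: "a < k" "a' < k" "c < k" "c' < k" and ac: "(a, a') \<noteq> (c, c')"
  shows "(\<integral>\<omega>. (cmod (ov \<omega> a a' c c'))\<^sup>2 \<partial>M) \<le> 4 / (real n)\<^sup>2 + \<kappa>\<^sup>2 / real n"
proof -
  have first: "(\<integral>\<omega>. (cmod (overlap n d B (block_row n (X \<omega>)) p p' q q'))\<^sup>2 \<partial>M) \<le> 4 / (real n)\<^sup>2 + \<kappa>\<^sup>2 / real n"
    if "haar_blocks M n k d B X \<kappa>" "p < k" "p' < k" "q < k" "q' < k" "p \<noteq> q" for p p' q q' B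
  proof (cases "p' = q \<and> q' = q")
    case True
    have "cmod (overlap n d B (block_row n (X \<omega>)) p p' q q') = cmod (overlap n d B (block_row n (X \<omega>)) q q' p p')" for \<omega>
      by (metis overlap_swap complex_mod_cnj)
    then show ?thesis
      using haar_blocks.ov_twist_bound[OF that(1), of q q' p p'] that True by auto
  next
    case False
    then show ?thesis using haar_blocks.ov_twist_bound[OF that(1), of p p' q q'] that by auto
  qed
  show ?thesis
  proof (cases "a = c")
    case True
    then show ?thesis using first[OF transpose l(2,1,4,3)] ac by (simp add: overlap_transpose[of n d A])
  next
    case False
    then show ?thesis using first[OF haar_blocks_axioms l] by simp
  qed
qed

text \<open>The rotated overlap has the same law, and its distance from 1/k^2 is bounded for each
  outcome by off-diagonal overlaps. The factor k^4 counts the ordered pairs of index pairs.\<close>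

lemma ov_diag_bound:
  assumes l: "a < k" "a' < k"
  shows "(\<integral>\<omega>. (cmod (ov \<omega> a a' a a' - 1 / (of_nat k)\<^sup>2))\<^sup>2 \<partial>M) \<le> real k ^ 4 * (4 / (real n)\<^sup>2 + \<kappa>\<^sup>2 / real n)"
proof -
  let ?I = "{..<k} \<times> {..<k}"
  let ?e = "1 / (of_nat k)\<^sup>2 :: complex"
  let ?b = "4 / (real n)\<^sup>2 + \<kappa>\<^sup>2 / real n"
  let ?h = "\<lambda>z. (cmod (z - ?e))\<^sup>2"
  let ?o = "\<lambda>s s' \<omega>. if s = s' then 0 else (cmod (ov \<omega> (fst s) (snd s) (fst s') (snd s')))\<^sup>2"
  have h: "?h \<in> borel_measurable borel" by measurable
  have e1: "cmod ?e \<le> 1" using k by (simp add: norm_divide norm_power field_simps)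
  obtain W where W: "unitary_mat (n * k) W"
    and rows: "\<And>X a b i. X \<in> carrier_mat (n * k) (n * k) \<Longrightarrow> a < k \<Longrightarrow> b < n \<Longrightarrow> i < n * k \<Longrightarrow>
      block_row n (W * X) a b i = (\<Sum>p<k. dft k a p * block_row n X p b i)"
    using rotate_unitary[where n = n and k = k] by blast
  have o_int: "integrable M (?o s s')" if "s \<in> ?I" "s' \<in> ?I" for s s'
    using ov_square_integrable[of "fst s" "snd s" "fst s'" "snd s'" 0] that
    by (cases "s = s'") (auto simp: mem_Times_iff)
  have o_le: "(\<integral>\<omega>. ?o s s' \<omega> \<partial>M) \<le> ?b" if "s \<in> ?I" "s' \<in> ?I" for s s'
    using ov_offdiag_bound[of "fst s" "snd s" "fst s'" "snd s'"] that
    by (cases "s = s'") (auto simp: prod_eq_iff)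
  have "(\<integral>\<omega>. ?h (ov \<omega> a a' a a') \<partial>M) = (\<integral>\<omega>. ?h (overlap n d A (block_row n (W * X \<omega>)) a a' a a') \<partial>M)"
    by (rule haar_invariance[OF W l l h, symmetric])
  also have "\<dots> \<le> (\<integral>\<omega>. (\<Sum>s\<in>?I. \<Sum>s'\<in>?I. ?o s s' \<omega>) \<partial>M)"
  proof (rule integral_mono)
    show "integrable M (\<lambda>\<omega>. ?h (overlap n d A (block_row n (W * X \<omega>)) a a' a a'))"
      by (intro haar_invariance_integrable[OF W l l h] ov_square_integrable l e1)
    show "integrable M (\<lambda>\<omega>. \<Sum>s\<in>?I. \<Sum>s'\<in>?I. ?o s s' \<omega>)"
      by (intro Bochner_Integration.integrable_sum o_int)
    fix \<omega> assume \<omega>: "\<omega> \<in> space M"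
    have "overlap n d A (block_row n (W * X \<omega>)) a a' a a' =
        overlap n d A (\<lambda>a b i. \<Sum>p<k. dft k a p * block_row n (X \<omega>) p b i) a a' a a'"
      using d by (intro overlap_cong[of k] l rows X_carrier \<omega>) auto
    then show "?h (overlap n d A (block_row n (W * X \<omega>)) a a' a a') \<le> (\<Sum>s\<in>?I. \<Sum>s'\<in>?I. ?o s s' \<omega>)"
      using overlap_rotate_diag[OF k trace_one[OF \<omega>], of a a'] by (simp only:)
  qed
  also have "\<dots> = (\<Sum>s\<in>?I. \<Sum>s'\<in>?I. \<integral>\<omega>. ?o s s' \<omega> \<partial>M)"
  proof -
    have "(\<integral>\<omega>. (\<Sum>s\<in>?I. \<Sum>s'\<in>?I. ?o s s' \<omega>) \<partial>M) = (\<Sum>s\<in>?I. \<integral>\<omega>. (\<Sum>s'\<in>?I. ?o s s' \<omega>) \<partial>M)"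
      by (intro Bochner_Integration.integral_sum Bochner_Integration.integrable_sum o_int)
    also have "\<dots> = (\<Sum>s\<in>?I. \<Sum>s'\<in>?I. \<integral>\<omega>. ?o s s' \<omega> \<partial>M)"
      by (intro sum.cong refl Bochner_Integration.integral_sum o_int)
    finally show ?thesis .
  qed
  also have "\<dots> \<le> (\<Sum>s\<in>?I. \<Sum>s'\<in>?I. ?b)"
    by (intro sum_mono o_le)
  also have "\<dots> = real k ^ 4 * ?b" by (simp add: power4_eq_xxxx)
  finally show ?thesis .
qed

end

section \<open>Matrices close to a scalar\<close>

lemma frobenius_of_mtrace:
  assumes A: "A \<in> carrier_mat d d" and tr: "mtrace (A * mat_adjoint A) = 1"
  shows "(\<Sum>i<d. \<Sum>j<d. (cmod (A $$ (i, j)))\<^sup>2) = 1"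
proof -
  have A': "mat_adjoint A \<in> carrier_mat d d"
    using A by (intro carrier_matI) (simp_all add: adjoint_dim)
  have "mtrace (A * mat_adjoint A) = (\<Sum>i<d. \<Sum>j<d. A $$ (i, j) * cnj (A $$ (i, j)))"
    unfolding mtrace_def using A
    by (intro sum.cong) (auto simp: mat_mult_index[OF A A'] adjoint_index)
  also have "\<dots> = complex_of_real (\<Sum>i<d. \<Sum>j<d. (cmod (A $$ (i, j)))\<^sup>2)"
    by (simp only: of_real_sum complex_norm_square)
  finally show ?thesis using tr by (metis of_real_eq_1_iff)
qed

text \<open>A nonzero vector is rescaled to the unit ball. The supremum defining
  \<open>opnorm\<close> is an upper bound only if the set is bounded above, which the
  Hilbert-Schmidt norm guarantees.\<close>

lemma contracts_opnorm:
  assumes A: "A \<in> carrier_mat d d"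
  shows "contracts d d (\<lambda>i j. A $$ (i, j)) (opnorm A)"
  unfolding contracts_def
proof
  fix v :: "nat \<Rightarrow> complex"
  let ?T = "{vnorm (A *\<^sub>v v) | v. v \<in> carrier_vec (dim_col A) \<and> vnorm v \<le> 1}"
  let ?H = "\<Sum>i<d. \<Sum>j<d. (cmod (A $$ (i, j)))\<^sup>2"
  have vn: "(vnorm (A *\<^sub>v w))\<^sup>2 = (\<Sum>i<d. (cmod (\<Sum>j<d. A $$ (i, j) * w $ j))\<^sup>2)" if "w \<in> carrier_vec d" for w
    using A that unfolding vnorm_def
    by (auto simp: sum_nonneg scalar_prod_def atLeast0LessThan)
  have vn2: "(vnorm w)\<^sup>2 = (\<Sum>i<d. (cmod (w $ i))\<^sup>2)" if "w \<in> carrier_vec d" for w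
    using that unfolding vnorm_def by (auto simp: sum_nonneg)
  have vn0: "0 \<le> vnorm w" for w unfolding vnorm_def by (simp add: sum_nonneg)
  have "vnorm (A *\<^sub>v w) \<le> sqrt ?H" if w: "w \<in> carrier_vec d" "vnorm w \<le> 1" for w
  proof (rule real_le_rsqrt)
    have "(vnorm (A *\<^sub>v w))\<^sup>2 \<le> (\<Sum>i<d. (\<Sum>j<d. (cmod (A $$ (i, j)))\<^sup>2) * (\<Sum>j<d. (cmod (w $ j))\<^sup>2))"
      unfolding vn[OF w(1)] by (intro sum_mono cmod_sum_mult_le)
    also have "\<dots> = ?H * (vnorm w)\<^sup>2"
      unfolding vn2[OF w(1)] by (simp only: sum_distrib_right)
    also have "\<dots> \<le> ?H * 1"
      using w(2) vn0[of w] by (intro mult_left_mono power_le_one sum_nonneg) auto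
    finally show "(vnorm (A *\<^sub>v w))\<^sup>2 \<le> ?H" by simp
  qed
  then have bdd: "bdd_above ?T" using A by (auto intro!: bdd_aboveI[of _ "sqrt ?H"])
  have le: "vnorm (A *\<^sub>v w) \<le> opnorm A" if "w \<in> carrier_vec d" "vnorm w \<le> 1" for w
    unfolding opnorm_def using A that by (intro cSup_upper[OF _ bdd]) auto
  define s where "s = (\<Sum>j<d. (cmod (v j))\<^sup>2)"
  show "(\<Sum>x<d. (cmod (\<Sum>y<d. A $$ (x, y) * v y))\<^sup>2) \<le> (opnorm A)\<^sup>2 * (\<Sum>y<d. (cmod (v y))\<^sup>2)"
  proof (cases "s = 0")
    case True
    then have "v j = 0" if "j < d" for j
      using that unfolding s_def by (subst (asm) sum_nonneg_eq_0_iff) auto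
    then show ?thesis by simp
  next
    case False
    then have s: "0 < s" unfolding s_def by (smt (verit) sum_nonneg zero_le_power2)
    define w where "w = vec d (\<lambda>j. v j / complex_of_real (sqrt s))"
    have w: "w \<in> carrier_vec d" unfolding w_def by simp
    have "(vnorm w)\<^sup>2 = (\<Sum>j<d. (cmod (v j))\<^sup>2 / s)"
      unfolding vn2[OF w] using s by (simp add: w_def norm_divide power_divide)
    also have "\<dots> = 1" using s by (simp add: s_def flip: sum_divide_distrib)
    finally have "vnorm w \<le> 1" using vn0[of w] by (simp add: power2_eq_1_iff)
    then have "(vnorm (A *\<^sub>v w))\<^sup>2 \<le> (opnorm A)\<^sup>2" using le[OF w] vn0 by (intro power_mono) auto
    moreover have "(vnorm (A *\<^sub>v w))\<^sup>2 = (\<Sum>x<d. (cmod (\<Sum>y<d. A $$ (x, y) * v y))\<^sup>2) / s"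
    proof -
      have "(\<Sum>j<d. A $$ (i, j) * w $ j) = (\<Sum>y<d. A $$ (i, y) * v y) / complex_of_real (sqrt s)" for i
        unfolding w_def by (simp add: sum_divide_distrib)
      then show ?thesis
        unfolding vn[OF w] using s by (simp add: norm_divide power_divide flip: sum_divide_distrib)
    qed
    ultimately show ?thesis using s by (simp add: field_simps s_def[symmetric])
  qed
qed

text \<open>Gershgorin's argument: the eigenvalue equation is read off at a coordinate where the
  eigenvector has largest modulus.\<close>

lemma eigenvalue_near_scalar:
  fixes Z :: "complex mat"
  assumes Z: "Z \<in> carrier_mat K K"
    and close: "\<And>x y. x < K \<Longrightarrow> y < K \<Longrightarrow> cmod (Z $$ (x, y) - (if x = y then \<mu> else 0)) \<le> \<eta>"
    and root: "poly (char_poly Z) l = 0"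
  shows "cmod (l - \<mu>) \<le> real K * \<eta>"
proof -
  obtain v where v: "v \<in> carrier_vec K" "v \<noteq> 0\<^sub>v K" "Z *\<^sub>v v = l \<cdot>\<^sub>v v"
    using root Z unfolding eigenvalue_root_char_poly[OF Z, symmetric] eigenvalue_def eigenvector_def by auto
  obtain i0 where i0: "i0 < K" "v $ i0 \<noteq> 0" using v(1,2) by (metis eq_vecI carrier_vecD index_zero_vec)
  define m where "m = Max ((\<lambda>i. cmod (v $ i)) ` {..<K})"
  have "m \<in> (\<lambda>i. cmod (v $ i)) ` {..<K}" unfolding m_def using i0 by (intro Max_in) auto
  then obtain i where i: "i < K" "m = cmod (v $ i)" by auto
  have le: "cmod (v $ j) \<le> m" if "j < K" for j unfolding m_def using that by (intro Max_ge) auto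
  have m: "0 < m" using le[OF i0(1)] i0(2) by (smt (verit) zero_less_norm_iff)
  have "(\<Sum>j<K. Z $$ (i, j) * v $ j) = l * v $ i"
    using arg_cong[OF v(3), of "\<lambda>u. u $ i"] Z v(1) i(1) by (auto simp: scalar_prod_def atLeast0LessThan)
  moreover have "(\<Sum>j<K. (if i = j then \<mu> else 0) * v $ j) = \<mu> * v $ i"
    using i(1) by (simp add: if_distrib[of "\<lambda>x. x * _"] cong: if_cong)
  ultimately have "(l - \<mu>) * v $ i = (\<Sum>j<K. (Z $$ (i, j) - (if i = j then \<mu> else 0)) * v $ j)"
    by (simp add: left_diff_distrib sum_subtractf)
  then have "cmod (l - \<mu>) * m = cmod (\<Sum>j<K. (Z $$ (i, j) - (if i = j then \<mu> else 0)) * v $ j)"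
    by (metis i(2) norm_mult)
  also have "\<dots> \<le> (\<Sum>j<K. \<eta> * m)"
  proof (intro sum_norm_le)
    fix j assume j: "j \<in> {..<K}"
    have "0 \<le> \<eta>" using close[OF i(1) i(1)] norm_ge_zero order.trans by blast
    then show "cmod ((Z $$ (i, j) - (if i = j then \<mu> else 0)) * v $ j) \<le> \<eta> * m"
      unfolding norm_mult using j i(1) le close by (intro mult_mono) auto
  qed
  also have "\<dots> = real K * \<eta> * m" by simp
  finally show ?thesis using m by simp
qed

text \<open>Every atom is the real part of a root within \<open>K * \<eta>\<close> of \<mu>, and
  averaging preserves the bound on \<open>f\<close>. The support is finite and nonempty, so
  \<open>f\<close> is integrable and the multiset defines a distribution.\<close>

lemma empirical_eig_near:
  fixes Z :: "complex mat" and f :: "real \<Rightarrow> real"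
  assumes Z: "Z \<in> carrier_mat K K" and K: "0 < K"
    and close: "\<And>x y. x < K \<Longrightarrow> y < K \<Longrightarrow> cmod (Z $$ (x, y) - (if x = y then complex_of_real \<mu> else 0)) \<le> \<eta>"
    and f: "\<And>x. \<bar>x - \<mu>\<bar> \<le> real K * \<eta> \<Longrightarrow> \<bar>f x - f \<mu>\<bar> \<le> \<epsilon>"
  shows "\<bar>integral\<^sup>L (empirical_eig Z) f - f \<mu>\<bar> \<le> \<epsilon>"
proof -
  let ?R = "image_mset Re (proots (char_poly Z))"
  let ?p = "pmf_of_multiset ?R"
  have deg: "degree (char_poly Z) = K" using degree_monic_char_poly[OF Z] by blast
  then have nz: "char_poly Z \<noteq> 0" using K by auto
  have "size (proots (char_poly Z)) = K" using size_proots_complex deg by metis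
  then have ne: "?R \<noteq> {#}" using K by auto
  have sp: "set_pmf ?p = Re ` {x. poly (char_poly Z) x = 0}"
    unfolding set_pmf_of_multiset[OF ne] using nz by simp
  have fin: "finite (set_pmf ?p)" unfolding set_pmf_of_multiset[OF ne] by simp
  have near: "\<bar>f x - f \<mu>\<bar> \<le> \<epsilon>" if x: "x \<in> set_pmf ?p" for x
  proof -
    obtain l where l: "poly (char_poly Z) l = 0" "x = Re l" using x unfolding sp by auto
    have "\<bar>x - \<mu>\<bar> \<le> cmod (l - complex_of_real \<mu>)" using abs_Re_le_cmod[of "l - complex_of_real \<mu>"] l by simp
    also have "\<dots> \<le> real K * \<eta>" by (rule eigenvalue_near_scalar[OF Z close l(1)])
    finally show ?thesis by (rule f)
  qed
  have int: "integrable (measure_pmf ?p) g" for g :: "real \<Rightarrow> real"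
    by (rule integrable_measure_pmf_finite[OF fin])
  have "integral\<^sup>L (measure_pmf ?p) f \<le> f \<mu> + \<epsilon>"
    using near by (intro measure_pmf.integral_le_const int) (force simp: AE_measure_pmf_iff)
  moreover have "f \<mu> - \<epsilon> \<le> integral\<^sup>L (measure_pmf ?p) f"
    using near by (intro measure_pmf.integral_ge_const int) (force simp: AE_measure_pmf_iff)
  ultimately show ?thesis unfolding empirical_eig_def by (simp add: abs_le_iff)
qed

text \<open>Handling powers entry by entry gives the trace moments without passing through
  eigenvalues.\<close>

lemma pow_mat_tendsto_scalar:
  fixes Z :: "'i \<Rightarrow> complex mat"
  assumes Z: "\<And>n. Z n \<in> carrier_mat K K"
    and lim: "\<And>x y. x < K \<Longrightarrow> y < K \<Longrightarrow> ((\<lambda>n. Z n $$ (x, y)) \<longlongrightarrow> (if x = y then \<mu> else 0)) F"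
    and "x < K" "y < K"
  shows "((\<lambda>n. (Z n ^\<^sub>m p) $$ (x, y)) \<longlongrightarrow> (if x = y then \<mu> ^ p else 0)) F"
  using assms(3,4)
proof (induction p arbitrary: x y)
  case 0
  have "(Z n ^\<^sub>m 0) $$ (x, y) = (if x = y then 1 else 0)" for n
    using Z[of n] 0 by simp
  then show ?case by simp
next
  case (Suc p)
  have e: "(Z n ^\<^sub>m Suc p) $$ (x, y) = (\<Sum>z<K. (Z n ^\<^sub>m p) $$ (x, z) * Z n $$ (z, y))" for n
    unfolding pow_mat.simps using mat_mult_index[OF pow_carrier_mat[OF Z[of n]] Z[of n]] Suc.prems by blast
  have "((\<lambda>n. (Z n ^\<^sub>m Suc p) $$ (x, y)) \<longlongrightarrow> (\<Sum>z<K. (if x = z then \<mu> ^ p else 0) * (if z = y then \<mu> else 0))) F"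
    unfolding e using Suc by (intro tendsto_sum tendsto_mult lim) auto
  also have "(\<Sum>z<K. (if x = z then \<mu> ^ p else 0) * (if z = y then \<mu> else 0)) =
     (\<Sum>z<K. if z = x then (if x = y then \<mu> ^ Suc p else 0) else 0)"
    by (intro sum.cong refl) auto
  also have "\<dots> = (if x = y then \<mu> ^ Suc p else 0)" using Suc.prems by simp
  finally show ?case .
qed

lemma pow_mat_entry_bound:
  fixes Z :: "complex mat"
  assumes Z: "Z \<in> carrier_mat K K"
    and le: "\<And>x y. x < K \<Longrightarrow> y < K \<Longrightarrow> cmod (Z $$ (x, y)) \<le> 1"
    and "x < K" "y < K"
  shows "cmod ((Z ^\<^sub>m p) $$ (x, y)) \<le> real K ^ p"
  using assms(3,4)
proof (induction p arbitrary: x y)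
  case 0
  then show ?case using Z by simp
next
  case (Suc p)
  have "cmod ((Z ^\<^sub>m Suc p) $$ (x, y)) = cmod (\<Sum>z<K. (Z ^\<^sub>m p) $$ (x, z) * Z $$ (z, y))"
    unfolding pow_mat.simps using mat_mult_index[OF pow_carrier_mat[OF Z] Z] Suc.prems by metis
  also have "\<dots> \<le> (\<Sum>z<K. real K ^ p * 1)"
  proof (rule sum_norm_le)
    fix z assume "z \<in> {..<K}"
    then show "cmod ((Z ^\<^sub>m p) $$ (x, z) * Z $$ (z, y)) \<le> real K ^ p * 1"
      unfolding norm_mult by (intro mult_mono Suc le) (use Suc.prems in auto)
  qed
  finally show ?case by simp
qed

lemma pow_mat_entry_measurable:
  fixes Z :: "'w \<Rightarrow> complex mat"
  assumes Z: "\<And>\<omega>. Z \<omega> \<in> carrier_mat K K"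
    and m: "\<And>x y. x < K \<Longrightarrow> y < K \<Longrightarrow> (\<lambda>\<omega>. Z \<omega> $$ (x, y)) \<in> borel_measurable M"
    and "x < K" "y < K"
  shows "(\<lambda>\<omega>. (Z \<omega> ^\<^sub>m p) $$ (x, y)) \<in> borel_measurable M"
  using assms(3,4)
proof (induction p arbitrary: x y)
  case 0
  have "(Z \<omega> ^\<^sub>m 0) $$ (x, y) = (if x = y then 1 else 0)" for \<omega>
    using Z[of \<omega>] 0 by simp
  then show ?case by simp
next
  case (Suc p)
  have e: "(Z \<omega> ^\<^sub>m Suc p) $$ (x, y) = (\<Sum>z<K. (Z \<omega> ^\<^sub>m p) $$ (x, z) * Z \<omega> $$ (z, y))" for \<omega>
    unfolding pow_mat.simps using mat_mult_index[OF pow_carrier_mat[OF Z[of \<omega>]] Z[of \<omega>]] Suc.prems by blast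
  show ?case unfolding e using Suc by (intro borel_measurable_sum borel_measurable_times m) auto
qed

text \<open>The sum of the \<open>Y n\<close> has finite expectation, hence is finite almost surely,
  and the terms of a convergent series tend to zero.\<close>

lemma AE_tendsto_zero_of_summable:
  fixes Y :: "nat \<Rightarrow> 'w \<Rightarrow> real"
  assumes int: "\<And>n. integrable M (Y n)" and nn: "\<And>n \<omega>. 0 \<le> Y n \<omega>"
    and sm: "summable (\<lambda>n. \<integral>\<omega>. Y n \<omega> \<partial>M)"
  shows "AE \<omega> in M. (\<lambda>n. Y n \<omega>) \<longlonglongrightarrow> 0"
proof -
  have I0: "0 \<le> (\<integral>\<omega>. Y n \<omega> \<partial>M)" for n using nn by simp
  have meas: "(\<lambda>\<omega>. ennreal (Y n \<omega>)) \<in> borel_measurable M" for n using int by measurable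
  have "(\<integral>\<^sup>+\<omega>. (\<Sum>n. ennreal (Y n \<omega>)) \<partial>M) = (\<Sum>n. \<integral>\<^sup>+\<omega>. ennreal (Y n \<omega>) \<partial>M)"
    by (rule nn_integral_suminf[OF meas])
  also have "\<dots> = (\<Sum>n. ennreal (\<integral>\<omega>. Y n \<omega> \<partial>M))"
    using nn by (intro suminf_cong nn_integral_eq_integral int) auto
  also have "\<dots> = ennreal (\<Sum>n. \<integral>\<omega>. Y n \<omega> \<partial>M)"
    by (rule suminf_ennreal2[OF I0 sm])
  finally have "(\<integral>\<^sup>+\<omega>. (\<Sum>n. ennreal (Y n \<omega>)) \<partial>M) \<noteq> \<infinity>" by simp
  then have "AE \<omega> in M. (\<Sum>n. ennreal (Y n \<omega>)) \<noteq> \<infinity>"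
    using meas by (intro nn_integral_PInf_AE borel_measurable_suminf_order) auto
  then show ?thesis
  proof eventually_elim
    case (elim \<omega>)
    then have "summable (\<lambda>n. Y n \<omega>)"
      using nn by (intro summable_suminf_not_top) auto
    then show ?case by (rule summable_LIMSEQ_zero)
  qed
qed

section \<open>Almost sure convergence\<close>

context haar_blocks
begin

text \<open>The squared Hilbert-Schmidt distance of the channel output from 1/k^2 times the
  identity.\<close>

definition deviation :: "'w \<Rightarrow> real" where
  "deviation \<omega> = (\<Sum>s\<in>{..<k} \<times> {..<k}. \<Sum>s'\<in>{..<k} \<times> {..<k}.
     (cmod (ov \<omega> (fst s) (snd s) (fst s') (snd s') - (if s = s' then 1 / (of_nat k)\<^sup>2 else 0)))\<^sup>2)"

lemma deviation_nonneg: "0 \<le> deviation \<omega>"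
  unfolding deviation_def by (intro sum_nonneg) auto

lemma deviation_term_integrable:
  assumes "s \<in> {..<k} \<times> {..<k}" "s' \<in> {..<k} \<times> {..<k}"
  shows "integrable M (\<lambda>\<omega>. (cmod (ov \<omega> (fst s) (snd s) (fst s') (snd s') - (if s = s' then 1 / (of_nat k)\<^sup>2 else 0)))\<^sup>2)"
proof -
  have "cmod (1 / (of_nat k)\<^sup>2) \<le> 1" using k by (simp add: norm_divide norm_power field_simps)
  then show ?thesis using assms by (intro ov_square_integrable) (auto simp: mem_Times_iff)
qed

lemma deviation_integrable: "integrable M deviation"
  unfolding deviation_def[abs_def] by (intro Bochner_Integration.integrable_sum deviation_term_integrable)

text \<open>There are k^4 entries, and the worst bound, the one for diagonal entries, carries
  another k^4.\<close>

lemma integral_deviation_le: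
  "(\<integral>\<omega>. deviation \<omega> \<partial>M) \<le> real k ^ 8 * (4 / (real n)\<^sup>2 + \<kappa>\<^sup>2 / real n)"
proof -
  let ?I = "{..<k} \<times> {..<k}"
  let ?b = "4 / (real n)\<^sup>2 + \<kappa>\<^sup>2 / real n"
  let ?t = "\<lambda>s s' \<omega>. (cmod (ov \<omega> (fst s) (snd s) (fst s') (snd s') - (if s = s' then 1 / (of_nat k)\<^sup>2 else 0)))\<^sup>2"
  have "1 \<le> real k ^ 4" using k by (intro one_le_power) simp
  then have b: "?b \<le> real k ^ 4 * ?b" using mult_right_mono[of 1 "real k ^ 4" ?b] by simp
  have "(\<integral>\<omega>. ?t s s' \<omega> \<partial>M) \<le> real k ^ 4 * ?b" if "s \<in> ?I" "s' \<in> ?I" for s s'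
  proof (cases "s = s'")
    case True
    then show ?thesis using ov_diag_bound[of "fst s" "snd s"] that by (auto simp: mem_Times_iff)
  next
    case False
    then show ?thesis
      using ov_offdiag_bound[of "fst s" "snd s" "fst s'" "snd s'"] that b
      by (auto simp: mem_Times_iff prod_eq_iff)
  qed
  then have "(\<Sum>s\<in>?I. \<Sum>s'\<in>?I. \<integral>\<omega>. ?t s s' \<omega> \<partial>M) \<le> (\<Sum>s\<in>?I. \<Sum>s'\<in>?I. real k ^ 4 * ?b)"
    by (intro sum_mono)
  also have "\<dots> = real k ^ 8 * ?b" by (simp add: power_numeral_reduce)
  also have "(\<Sum>s\<in>?I. \<Sum>s'\<in>?I. \<integral>\<omega>. ?t s s' \<omega> \<partial>M) = (\<Sum>s\<in>?I. \<integral>\<omega>. (\<Sum>s'\<in>?I. ?t s s' \<omega>) \<partial>M)"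
    by (intro sum.cong refl Bochner_Integration.integral_sum[symmetric] deviation_term_integrable)
  also have "\<dots> = (\<integral>\<omega>. deviation \<omega> \<partial>M)"
    unfolding deviation_def
    by (intro Bochner_Integration.integral_sum[symmetric] Bochner_Integration.integrable_sum deviation_term_integrable)
  finally show ?thesis .
qed

lemma entry_deviation:
  assumes "a < k" "a' < k" "c < k" "c' < k"
  shows "(cmod (ov \<omega> a a' c c' - (if (a, a') = (c, c') then 1 / (of_nat k)\<^sup>2 else 0)))\<^sup>2 \<le> deviation \<omega>"
proof -
  let ?I = "{..<k} \<times> {..<k}"
  let ?t = "\<lambda>s s'. (cmod (ov \<omega> (fst s) (snd s) (fst s') (snd s') - (if s = s' then 1 / (of_nat k)\<^sup>2 else 0)))\<^sup>2"
  have "?t (a, a') (c, c') \<le> (\<Sum>s'\<in>?I. ?t (a, a') s')"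
    using assms by (intro member_le_sum[of "(c, c')" ?I "?t (a, a')"]) auto
  also have "\<dots> \<le> deviation \<omega>"
    unfolding deviation_def using assms
    by (intro member_le_sum[of "(a, a')" ?I "\<lambda>s. \<Sum>s'\<in>?I. ?t s s'"]) (auto intro: sum_nonneg)
  finally show ?thesis by simp
qed

end

theorem theorem4p1:
  fixes k :: nat and t :: real
    and A :: "nat \<Rightarrow> complex mat"
    and M :: "'w measure" and U :: "nat \<Rightarrow> 'w \<Rightarrow> complex mat"
  defines "S \<equiv> {n :: nat. 0 < n \<and> t * real n * real k \<in> \<nat>}"
  defines "d \<equiv> (\<lambda>n :: nat. nat \<lfloor>t * real n * real k\<rfloor>)"
  defines "F \<equiv> inf sequentially (principal S)"
  defines "Z \<equiv> (\<lambda>n \<omega>. tensor_map (d n) k (chanC k n (d n) (U n \<omega>)) (chanC k n (d n) (U n \<omega>))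
                          (ketbra (psi_vec (d n) (A n))))"
  assumes k: "k \<ge> 2"
    and t: "0 < t" "t \<le> 1"
    and A_dim: "\<And>n. n \<in> S \<Longrightarrow> A n \<in> carrier_mat (d n) (d n)"
    and A_norm: "\<And>n. n \<in> S \<Longrightarrow> mtrace (A n * mat_adjoint (A n)) = 1"
    and assm1: "\<exists>m :: complex.
       (\<lambda>n. cmod (mtrace (A n) / complex_of_real (sqrt (t * real n * real k)) - m))
         \<in> O[F](\<lambda>n. 1 / real n ^ 2)"
    and assm2: "(\<lambda>n. opnorm (A n)) \<in> O[F](\<lambda>n. 1 / sqrt (real n))"
    and M: "prob_space M"
    and haar: "\<And>n. n \<in> S \<Longrightarrow> haar_distributed M (n * k) (U n)"
  shows "(AE \<omega> in M. weak_conv_along (\<lambda>n. empirical_eig (Z n \<omega>))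
            (measure_pmf (return_pmf (1 / real k ^ 2))) F)
       \<and> (\<forall>p \<ge> 1. ((\<lambda>n. \<integral>\<omega>. mtrace (Z n \<omega> ^\<^sub>m p) \<partial>M)
            \<longlongrightarrow> complex_of_real (real k ^ 2 * (1 / real k ^ 2) ^ p)) F)"
proof -
  interpret prob_space M by (rule M)
  define K where "K = k * k"
  define \<mu> where "\<mu> = 1 / real k ^ 2"
  have K: "0 < K" using k by (simp add: K_def)
  have k0: "0 < k" using k by simp
  have mu: "complex_of_real \<mu> = 1 / (of_nat k)\<^sup>2" unfolding \<mu>_def by simp
  have Zc: "Z n \<omega> \<in> carrier_mat K K" for n \<omega>
    unfolding Z_def tensor_map_def K_def by simp
  have blocks: "haar_blocks M n k (d n) (\<lambda>i j. A n $$ (i, j)) (U n) (opnorm (A n))" if "n \<in> S" for n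
  proof unfold_locales
    have "t * real n * real k \<le> 1 * (real n * real k)"
      using t by (subst mult.assoc, intro mult_right_mono) auto
    then have "t * real n * real k \<le> real (n * k)" by simp
    then have "\<lfloor>t * real n * real k\<rfloor> \<le> int (n * k)" by linarith
    then show "d n \<le> n * k" unfolding d_def by linarith
    show "0 < n" using that unfolding S_def by simp
  qed (use haar k0 that A_dim A_norm in \<open>auto intro: frobenius_of_mtrace contracts_opnorm\<close>)
  have Zov: "Z n \<omega> $$ (x, y) = overlap n (d n) (\<lambda>i j. A n $$ (i, j)) (block_row n (U n \<omega>))
      (x div k) (x mod k) (y div k) (y mod k)"
    if "n \<in> S" "\<omega> \<in> space M" "x < K" "y < K" for n \<omega> x y
  proof -
    have l: "x div k < k" "x mod k < k" "y div k < k" "y mod k < k"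
      using that k0 unfolding K_def by (auto simp: less_mult_imp_div_less)
    show ?thesis
      using tensor_chanC_index[OF haar_blocks.X_carrier[OF blocks[OF that(1)] that(2)] haar_blocks.d[OF blocks[OF that(1)]] l, of "A n"]
      unfolding Z_def by simp
  qed
  have idx: "x div k < k" "x mod k < k" if "x < K" for x
    using that k0 unfolding K_def by (auto simp: less_mult_imp_div_less)
  have same: "(x div k, x mod k) = (y div k, y mod k) \<longleftrightarrow> x = y" for x y
    by (metis div_mult_mod_eq prod.inject)
  define dev where "dev n = haar_blocks.deviation n k (d n) (\<lambda>i j. A n $$ (i, j)) (U n)" for n
  have Zdev: "(cmod (Z n \<omega> $$ (x, y) - (if x = y then complex_of_real \<mu> else 0)))\<^sup>2 \<le> dev n \<omega>"
    if "n \<in> S" "\<omega> \<in> space M" "x < K" "y < K" for n \<omega> x y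
    using haar_blocks.entry_deviation[OF blocks[OF that(1)] idx[OF that(3)] idx[OF that(4)], of \<omega>]
    unfolding Zov[OF that] mu dev_def same .

  from assm2 obtain c where c: "0 < c" "\<forall>\<^sub>F n in F. norm (opnorm (A n)) \<le> c * norm (1 / sqrt (real n))"
    by (auto elim: landau_o.bigE)
  then obtain n0 where n0: "\<And>n. n0 \<le> n \<Longrightarrow> n \<in> S \<Longrightarrow> norm (opnorm (A n)) \<le> c * norm (1 / sqrt (real n))"
    unfolding F_def eventually_inf_principal eventually_sequentially by blast
  have op2: "(opnorm (A n))\<^sup>2 \<le> c\<^sup>2 / real n" if "n0 \<le> n" "n \<in> S" for n
  proof -
    have "(opnorm (A n))\<^sup>2 = (norm (opnorm (A n)))\<^sup>2" by simp
    also have "\<dots> \<le> (c * norm (1 / sqrt (real n)))\<^sup>2" by (intro power_mono n0 that) simp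
    finally show ?thesis by (simp add: power_mult_distrib power_divide)
  qed
  \<comment> \<open>Padding by zero gives an ordinary sequence with summable means; the limit along
    \<open>F\<close> is recovered because \<open>F\<close> is finer than
    \<open>sequentially\<close>.\<close>
  define Y where "Y n \<omega> = (if n0 \<le> n \<and> n \<in> S then dev n \<omega> else 0)" for n \<omega>
  have Yint: "integrable M (Y n)" for n
    unfolding Y_def dev_def using haar_blocks.deviation_integrable[OF blocks]
    by (cases "n0 \<le> n \<and> n \<in> S") auto
  have Ynn: "0 \<le> Y n \<omega>" for n \<omega>
    unfolding Y_def dev_def using haar_blocks.deviation_nonneg[OF blocks] by auto
  \<comment> \<open>The 4 comes from two occurrences of the twisted index; the squared
    \<open>c\<close> comes from the operator norm, whose square is at most that over n and is
    divided by n once more.\<close>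
  define C where "C = real k ^ 8 * (4 + c\<^sup>2)"
  have Yle: "(\<integral>\<omega>. Y n \<omega> \<partial>M) \<le> C * (1 / (real n)\<^sup>2)" for n
  proof (cases "n0 \<le> n \<and> n \<in> S")
    case True
    then have n: "0 < n" unfolding S_def by simp
    have "(\<integral>\<omega>. Y n \<omega> \<partial>M) \<le> real k ^ 8 * (4 / (real n)\<^sup>2 + (opnorm (A n))\<^sup>2 / real n)"
      using haar_blocks.integral_deviation_le[OF blocks, of n] True unfolding Y_def dev_def by simp
    also have "\<dots> \<le> real k ^ 8 * (4 / (real n)\<^sup>2 + (c\<^sup>2 / real n) / real n)"
      using op2[of n] True by (intro mult_left_mono add_left_mono divide_right_mono) auto
    also have "\<dots> = C * (1 / (real n)\<^sup>2)" using n unfolding C_def by (simp add: field_simps power2_eq_square)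
    finally show ?thesis .
  next
    case False
    then show ?thesis unfolding Y_def C_def by auto
  qed
  have "summable (\<lambda>n. C * (1 / (real n)\<^sup>2))"
    using inverse_power_summable[of 2, where ?'a = real] by (intro summable_mult) (simp add: inverse_eq_divide)
  then have Ysum: "summable (\<lambda>n. \<integral>\<omega>. Y n \<omega> \<partial>M)"
    by (rule summable_comparison_test'[of _ 0]) (use Yle Ynn in auto)
  have AEY: "AE \<omega> in M. \<omega> \<in> space M \<and> (\<lambda>n. Y n \<omega>) \<longlonglongrightarrow> 0"
    using AE_tendsto_zero_of_summable[OF Yint Ynn Ysum] by (simp add: AE_conj_iff)
  have Zlim: "((\<lambda>n. Z n \<omega> $$ (x, y)) \<longlongrightarrow> (if x = y then complex_of_real \<mu> else 0)) F"
    if \<omega>: "\<omega> \<in> space M" "(\<lambda>n. Y n \<omega>) \<longlonglongrightarrow> 0" and xy: "x < K" "y < K" for \<omega> x y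
  proof -
    let ?e = "\<lambda>n. Z n \<omega> $$ (x, y) - (if x = y then complex_of_real \<mu> else 0)"
    have "(\<lambda>n. sqrt (Y n \<omega>)) \<longlonglongrightarrow> 0" using tendsto_real_sqrt[OF \<omega>(2)] by simp
    then have "((\<lambda>n. sqrt (Y n \<omega>)) \<longlongrightarrow> 0) F"
      unfolding F_def by (rule tendsto_mono[rotated]) simp
    moreover have "\<forall>\<^sub>F n in F. norm (?e n) \<le> sqrt (Y n \<omega>)"
      unfolding F_def eventually_inf_principal eventually_sequentially
    proof (intro exI allI impI)
      fix n assume "n0 \<le> n" "n \<in> S"
      then show "norm (?e n) \<le> sqrt (Y n \<omega>)"
        using Zdev[OF _ \<omega>(1) xy, of n] unfolding Y_def by (intro real_le_rsqrt) simp
    qed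
    ultimately have "(?e \<longlongrightarrow> 0) F" by (rule Lim_null_comparison[rotated])
    then show ?thesis by (simp only: LIM_zero_iff)
  qed
  have weak: "AE \<omega> in M. weak_conv_along (\<lambda>n. empirical_eig (Z n \<omega>)) (measure_pmf (return_pmf \<mu>)) F"
    using AEY
  proof eventually_elim
    case (elim \<omega>)
    show ?case unfolding weak_conv_along_def
    proof (intro allI impI, elim conjE)
      fix f :: "real \<Rightarrow> real" assume f: "continuous_on UNIV f"
      have ret: "integral\<^sup>L (measure_pmf (return_pmf \<mu>)) f = f \<mu>"
        by (subst integral_measure_pmf[where A = "{\<mu>}"]) auto
      show "((\<lambda>n. integral\<^sup>L (empirical_eig (Z n \<omega>)) f) \<longlongrightarrow> integral\<^sup>L (measure_pmf (return_pmf \<mu>)) f) F"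
        unfolding ret
      proof (rule tendstoI)
        fix e :: real assume e: "0 < e"
        obtain \<delta> where \<delta>: "0 < \<delta>" "\<And>x. \<bar>x - \<mu>\<bar> < \<delta> \<Longrightarrow> \<bar>f x - f \<mu>\<bar> < e / 2"
          using f[unfolded continuous_on_iff, rule_format, of \<mu> "e / 2"] e by (auto simp: dist_real_def)
        \<comment> \<open>The eigenvalue estimate loses a factor \<open>K\<close>, so entries this
          close keep all eigenvalues within \<delta>/2 of \<mu>.\<close>
        define \<eta> where "\<eta> = \<delta> / (2 * real K)"
        have \<eta>: "0 < \<eta>" "real K * \<eta> < \<delta>" using \<delta>(1) K unfolding \<eta>_def by auto
        have "\<forall>\<^sub>F n in F. \<forall>x\<in>{..<K}. \<forall>y\<in>{..<K}. dist (Z n \<omega> $$ (x, y)) (if x = y then complex_of_real \<mu> else 0) < \<eta>"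
          using elim \<eta>(1) by (intro eventually_ball_finite ballI tendstoD[OF Zlim]) auto
        then show "\<forall>\<^sub>F n in F. dist (integral\<^sup>L (empirical_eig (Z n \<omega>)) f) (f \<mu>) < e"
        proof eventually_elim
          case (elim n)
          have "\<bar>integral\<^sup>L (empirical_eig (Z n \<omega>)) f - f \<mu>\<bar> \<le> e / 2"
          proof (rule empirical_eig_near[OF Zc K])
            show "cmod (Z n \<omega> $$ (x, y) - (if x = y then complex_of_real \<mu> else 0)) \<le> \<eta>" if "x < K" "y < K" for x y
              using elim that by (auto simp: dist_norm less_imp_le)
            show "\<bar>f x - f \<mu>\<bar> \<le> e / 2" if "\<bar>x - \<mu>\<bar> \<le> real K * \<eta>" for x
              using \<delta>(2)[of x] that \<eta>(2) by linarith
          qed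
          then show ?case using e by (simp add: dist_real_def)
        qed
      qed
    qed
  qed
  have moments: "((\<lambda>n. \<integral>\<omega>. mtrace (Z n \<omega> ^\<^sub>m p) \<partial>M) \<longlongrightarrow> complex_of_real (real k ^ 2 * \<mu> ^ p)) F" for p
  proof -
    let ?L = "complex_of_real (real k ^ 2 * \<mu> ^ p)"
    have tr: "mtrace (Z n \<omega> ^\<^sub>m p) = (\<Sum>x<K. (Z n \<omega> ^\<^sub>m p) $$ (x, x))" for n \<omega>
      unfolding mtrace_def using pow_carrier_mat[OF Zc[of n \<omega>], of p] by auto
    \<comment> \<open>Dominated convergence is applied to a sequence over all n, so the gaps outside
      \<open>S\<close> are filled with the expected limit; the dominating constant has to cover this
      value too.\<close>
    define s where "s n \<omega> = (if n \<in> S then mtrace (Z n \<omega> ^\<^sub>m p) else ?L)" for n \<omega>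
    have Zm: "(\<lambda>\<omega>. Z n \<omega> $$ (x, y)) \<in> borel_measurable M" if "n \<in> S" "x < K" "y < K" for n x y
      using haar_blocks.ov_measurable[OF blocks[OF that(1)] idx[OF that(2)] idx[OF that(3)]]
      by (simp add: Zov[OF that(1) _ that(2,3)] cong: measurable_cong)
    have Zb: "cmod (Z n \<omega> $$ (x, y)) \<le> 1" if "n \<in> S" "\<omega> \<in> space M" "x < K" "y < K" for n \<omega> x y
      unfolding Zov[OF that] by (rule haar_blocks.norm_ov_le[OF blocks[OF that(1)] that(2) idx[OF that(3)] idx[OF that(4)]])
    have "(\<lambda>n. \<integral>\<omega>. s n \<omega> \<partial>M) \<longlonglongrightarrow> (\<integral>\<omega>. ?L \<partial>M)"
    proof (rule integral_dominated_convergence[where w = "\<lambda>_. max (real K * real K ^ p) (cmod ?L)"])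
      show "s n \<in> borel_measurable M" for n
        unfolding s_def[abs_def] tr
        by (cases "n \<in> S") (auto intro!: borel_measurable_sum pow_mat_entry_measurable[OF Zc] Zm)
      show "AE \<omega> in M. norm (s n \<omega>) \<le> max (real K * real K ^ p) (cmod ?L)" for n
      proof (rule AE_I2)
        fix \<omega> assume \<omega>: "\<omega> \<in> space M"
        show "norm (s n \<omega>) \<le> max (real K * real K ^ p) (cmod ?L)"
        proof (cases "n \<in> S")
          case True
          have "norm (\<Sum>x<K. (Z n \<omega> ^\<^sub>m p) $$ (x, x)) \<le> (\<Sum>x<K. real K ^ p)"
            by (intro sum_norm_le pow_mat_entry_bound[OF Zc] Zb True \<omega>) auto
          then show ?thesis using True unfolding s_def tr by simp
        qed (simp add: s_def)
      qed
      show "AE \<omega> in M. (\<lambda>n. s n \<omega>) \<longlonglongrightarrow> ?L"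
        using AEY
      proof eventually_elim
        case (elim \<omega>)
        have "((\<lambda>n. \<Sum>x<K. (Z n \<omega> ^\<^sub>m p) $$ (x, x)) \<longlongrightarrow> (\<Sum>x<K. if x = x then complex_of_real \<mu> ^ p else 0)) F"
          using elim by (intro tendsto_sum pow_mat_tendsto_scalar[OF Zc] Zlim) auto
        moreover have "(\<Sum>x<K. if x = x then complex_of_real \<mu> ^ p else 0) = ?L"
          by (simp add: K_def power2_eq_square)
        ultimately have "((\<lambda>n. mtrace (Z n \<omega> ^\<^sub>m p)) \<longlongrightarrow> ?L) F" unfolding tr by (simp only:)
        \<comment> \<open>Outside \<open>S\<close> the sequence already equals its limit, so
          convergence along \<open>F\<close> extends to all n.\<close>
        then show ?case
          unfolding tendsto_def F_def eventually_inf_principal s_def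
          by (auto elim!: eventually_mono dest!: spec)
      qed
    qed auto
    then have "(\<lambda>n. \<integral>\<omega>. s n \<omega> \<partial>M) \<longlonglongrightarrow> ?L" by (simp add: prob_space)
    then have "((\<lambda>n. \<integral>\<omega>. s n \<omega> \<partial>M) \<longlongrightarrow> ?L) F"
      unfolding F_def by (rule tendsto_mono[rotated]) simp
    moreover have "\<forall>\<^sub>F n in F. (\<integral>\<omega>. s n \<omega> \<partial>M) = (\<integral>\<omega>. mtrace (Z n \<omega> ^\<^sub>m p) \<partial>M)"
      unfolding F_def eventually_inf_principal s_def by simp
    ultimately show ?thesis by (rule Lim_transform_eventually)
  qed
  show ?thesis using weak moments unfolding \<mu>_def by blast
qed

end
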